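(* Let $M,N$ be manifolds and let $\Pi\subset M\times N$ be a $\mathcal{C}^1$-submanifold of codimension $1$ that is transverse at $z_0=(x_0,y_0)\in\Pi$. Then the following are equivalent: (1) There are neighbourhoods $U,V$ of $x_0$ and $y_0$ in $M,N$ such that for every $x,x'\in U$ and $y\in V$ with $(x,y),(x',y)\in\Pi$, one has $T_y\Pi_x=T_y\Pi_{x'}$. (2) There are neighbourhoods $U,V$ of $x_0$ and $y_0$ in $M,N$ such that for every $x\in U$ and $y,y'\in V$ with $(x,y),(x,y')\in\Pi$, one has $T_x\Pi^y=T_x\Pi^{y'}$. (3) There are neighbourhoods $U,V$ of $x_0$ and $y_0$ in $M,N$ and $\mathcal{C}^1$ submersions $f\colon U\to\mathbf{R}$ and $g\colon V\to\mathbf{R}$ with $\Pi\cap(U\times V)=\{(x,y)\in U\times V: f(x)=g(y)\}$.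
   Context: $\Pi$ is transverse at $z=(x,y)\in\Pi$ if the tangent space $T_z\Pi\subset T_xM\oplus T_yN$ maps surjectively onto each factor $T_xM$ and $T_yN$. In that case $\Pi_x=\{y'\in N:(x,y')\in\Pi\}$ and $\Pi^y=\{x'\in M:(x',y)\in\Pi\}$ are codimension $1$ submanifolds near $y$ and $x$ respectively. Transversality is an open condition on $\Pi$; in (1) and (2) the neighbourhoods are understood to be small enough for the tangent spaces to make sense. *)

theory Defs
  imports "HOL-Analysis.Analysis"
begin

text \<open>
  Continuous differentiability on an open subset of a Euclidean space. (The library's
  \<^const>\<open>C1_differentiable_on\<close> only concerns functions of one real variable.)
\<close>

definition c1_on :: "('a::euclidean_space \<Rightarrow> 'b::euclidean_space) \<Rightarrow> 'a set \<Rightarrow> bool" where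
  "c1_on f S \<longleftrightarrow>
     open S \<and>
     (\<exists>f' :: 'a \<Rightarrow> 'a \<Rightarrow>\<^sub>L 'b.
        (\<forall>x\<in>S. (f has_derivative blinfun_apply (f' x)) (at x)) \<and> continuous_on S f')"


subsection \<open>Manifolds\<close>

text \<open>
  A chart is a pair of its domain and its coordinate map; the values of the
  coordinate map outside the domain are irrelevant.
\<close>

type_synonym ('a, 'e) chart = "'a set \<times> ('a \<Rightarrow> 'e)"

record ('a, 'e) manifold =
  mtop :: "'a topology"
  atlas :: "('a, 'e) chart set"

definition chart_on :: "'a topology \<Rightarrow> ('a, 'e::euclidean_space) chart \<Rightarrow> bool" where
  "chart_on X c \<longleftrightarrow>
     (case c of (U, \<phi>) \<Rightarrow>
        openin X U \<and> open (\<phi> ` U) \<and>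
        homeomorphic_map (subtopology X U) (top_of_set (\<phi> ` U)) \<phi>)"

definition c1_compatible ::
  "('a, 'e::euclidean_space) chart \<Rightarrow> ('a, 'e) chart \<Rightarrow> bool" where
  "c1_compatible c d \<longleftrightarrow>
     (case (c, d) of ((U, \<phi>), (V, \<psi>)) \<Rightarrow>
        c1_on (\<psi> \<circ> inv_into U \<phi>) (\<phi> ` (U \<inter> V)) \<and>
        c1_on (\<phi> \<circ> inv_into V \<psi>) (\<psi> ` (U \<inter> V)))"

text \<open>
  The atlas need not be maximal, so a smooth atlas qualifies too. The dimension is
  the dimension of the model space \<open>'e\<close>; it is positive, as for every \<^class>\<open>euclidean_space\<close>.
\<close>

definition c1_manifold :: "('a, 'e::euclidean_space) manifold \<Rightarrow> bool" where
  "c1_manifold M \<longleftrightarrow>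
     Hausdorff_space (mtop M) \<and> second_countable (mtop M) \<and>
     (\<forall>c\<in>atlas M. chart_on (mtop M) c) \<and>
     (\<Union>c\<in>atlas M. fst c) = topspace (mtop M) \<and>
     (\<forall>c\<in>atlas M. \<forall>d\<in>atlas M. c1_compatible c d)"

definition maximal_atlas :: "('a, 'e::euclidean_space) manifold \<Rightarrow> ('a, 'e) chart set" where
  "maximal_atlas M = {c. chart_on (mtop M) c \<and> (\<forall>d\<in>atlas M. c1_compatible c d)}"

definition euclidean_manifold :: "('e, 'e::euclidean_space) manifold" where
  "euclidean_manifold = \<lparr>mtop = euclidean, atlas = {(UNIV, \<lambda>x. x)}\<rparr>"

definition prod_manifold ::
  "('a, 'e::euclidean_space) manifold \<Rightarrow> ('b, 'f::euclidean_space) manifold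
    \<Rightarrow> ('a \<times> 'b, 'e \<times> 'f) manifold" where
  "prod_manifold M N =
     \<lparr>mtop = prod_topology (mtop M) (mtop N),
      atlas = {(U \<times> V, map_prod \<phi> \<psi>) | U \<phi> V \<psi>. (U, \<phi>) \<in> atlas M \<and> (V, \<psi>) \<in> atlas N}\<rparr>"

definition c1_map_on ::
  "('a, 'e::euclidean_space) manifold \<Rightarrow> ('b, 'f::euclidean_space) manifold
    \<Rightarrow> 'a set \<Rightarrow> ('a \<Rightarrow> 'b) \<Rightarrow> bool" where
  "c1_map_on M N U f \<longleftrightarrow>
     openin (mtop M) U \<and> continuous_map (subtopology (mtop M) U) (mtop N) f \<and>
     (\<forall>(V, \<phi>)\<in>atlas M. \<forall>(W, \<psi>)\<in>atlas N.
        c1_on (\<psi> \<circ> f \<circ> inv_into V \<phi>) (\<phi> ` {x \<in> U \<inter> V. f x \<in> W}))"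

text \<open>Embedded submanifolds, given by slice charts; they need not be closed.\<close>

definition c1_submanifold ::
  "('a, 'e::euclidean_space) manifold \<Rightarrow> nat \<Rightarrow> 'a set \<Rightarrow> bool" where
  "c1_submanifold M codim S \<longleftrightarrow>
     S \<subseteq> topspace (mtop M) \<and>
     (\<forall>p\<in>S. \<exists>W \<psi>. (W, \<psi>) \<in> maximal_atlas M \<and> p \<in> W \<and>
        (\<exists>H. subspace H \<and> dim H + codim = DIM('e) \<and> \<psi> ` (W \<inter> S) = \<psi> ` W \<inter> H))"


subsection \<open>Tangent spaces\<close>

text \<open>
  Tangent vectors are equivalence classes of curves defined near time \<open>0\<close>; the
  values of the representing functions away from \<open>0\<close> are irrelevant.
\<close>

definition c1_curve_at ::
  "('a, 'e::euclidean_space) manifold \<Rightarrow> 'a \<Rightarrow> (real \<Rightarrow> 'a) \<Rightarrow> bool" where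
  "c1_curve_at M p \<gamma> \<longleftrightarrow>
     \<gamma> 0 = p \<and> (\<exists>\<epsilon>>0. c1_map_on euclidean_manifold M {-\<epsilon><..<\<epsilon>} \<gamma>)"

definition velocity ::
  "('a, 'e::euclidean_space) manifold \<Rightarrow> (real \<Rightarrow> 'a) \<Rightarrow> (real \<Rightarrow> 'a) set" where
  "velocity M \<gamma> =
     {\<delta>. c1_curve_at M (\<gamma> 0) \<delta> \<and>
         (\<forall>(U, \<phi>)\<in>atlas M. \<gamma> 0 \<in> U \<longrightarrow>
            vector_derivative (\<phi> \<circ> \<delta>) (at 0) = vector_derivative (\<phi> \<circ> \<gamma>) (at 0))}"

definition tangent_space ::
  "('a, 'e::euclidean_space) manifold \<Rightarrow> 'a \<Rightarrow> (real \<Rightarrow> 'a) set set" where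
  "tangent_space M p = {velocity M \<gamma> | \<gamma>. c1_curve_at M p \<gamma>}"

text \<open>
  The tangent space at \<open>p\<close> of a set \<open>S\<close> that is a submanifold of \<open>M\<close> near \<open>p\<close>, as a
  subset of the tangent space of \<open>M\<close>.
\<close>

definition sub_tangent_space ::
  "('a, 'e::euclidean_space) manifold \<Rightarrow> 'a set \<Rightarrow> 'a \<Rightarrow> (real \<Rightarrow> 'a) set set" where
  "sub_tangent_space M S p =
     {velocity M \<gamma> | \<gamma>. c1_curve_at M p \<gamma> \<and> (\<forall>\<^sub>F t in nhds 0. \<gamma> t \<in> S)}"

text \<open>
  The differential of \<open>f\<close>, as a map into the tangent space of \<open>N\<close>. All members of the
  union coincide if \<open>f\<close> is continuously differentiable near the base point of \<open>v\<close>.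
\<close>

definition differential ::
  "('b, 'f::euclidean_space) manifold \<Rightarrow> ('a \<Rightarrow> 'b) \<Rightarrow> (real \<Rightarrow> 'a) set \<Rightarrow> (real \<Rightarrow> 'b) set" where
  "differential N f v = (\<Union>\<gamma>\<in>v. velocity N (f \<circ> \<gamma>))"

definition c1_submersion_on ::
  "('a, 'e::euclidean_space) manifold \<Rightarrow> ('b, 'f::euclidean_space) manifold
    \<Rightarrow> 'a set \<Rightarrow> ('a \<Rightarrow> 'b) \<Rightarrow> bool" where
  "c1_submersion_on M N U f \<longleftrightarrow>
     c1_map_on M N U f \<and>
     (\<forall>x\<in>U. differential N f ` tangent_space M x = tangent_space N (f x))"


subsection \<open>Transversality\<close>

text \<open>
  The components of a tangent vector of the product under its identification with a
  pair of tangent vectors are its images under the differentials of the projections.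
\<close>

definition transverse_at ::
  "('a, 'e::euclidean_space) manifold \<Rightarrow> ('b, 'f::euclidean_space) manifold
    \<Rightarrow> ('a \<times> 'b) set \<Rightarrow> 'a \<times> 'b \<Rightarrow> bool" where
  "transverse_at M N P z \<longleftrightarrow>
     differential M fst ` sub_tangent_space (prod_manifold M N) P z = tangent_space M (fst z) \<and>
     differential N snd ` sub_tangent_space (prod_manifold M N) P z = tangent_space N (snd z)"

definition xslice :: "('a \<times> 'b) set \<Rightarrow> 'a \<Rightarrow> 'b set" where
  "xslice P x = {y'. (x, y') \<in> P}"

definition yslice :: "('a \<times> 'b) set \<Rightarrow> 'b \<Rightarrow> 'a set" where
  "yslice P y = {x'. (x', y) \<in> P}"

text \<open>
  Open neighbourhoods of the two components of \<open>z\<close>, so small that \<open>P\<close> is transverse at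
  all its points in their product and hence the slices have tangent spaces there.
\<close>

definition transverse_nhds ::
  "('a, 'e::euclidean_space) manifold \<Rightarrow> ('b, 'f::euclidean_space) manifold
    \<Rightarrow> ('a \<times> 'b) set \<Rightarrow> 'a \<times> 'b \<Rightarrow> 'a set \<Rightarrow> 'b set \<Rightarrow> bool" where
  "transverse_nhds M N P z U V \<longleftrightarrow>
     openin (mtop M) U \<and> fst z \<in> U \<and> openin (mtop N) V \<and> snd z \<in> V \<and>
     (\<forall>w \<in> P \<inter> (U \<times> V). transverse_at M N P w)"

end

theory Submission
  imports Defs
begin

text \<open>
  Near the base point the hypersurface is, in charts, the zero set of a continuously differentiable
  function \<open>F (p, q)\<close> with nonzero differential, and it is transverse exactly where neither
  partial differential of \<open>F\<close> vanishes (\<open>transverse_imp_nonzero\<close>, \<open>nonzero_imp_transverse\<close>).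
  In particular transversality holds on a whole neighbourhood.

  That \<open>cond3\<close> implies \<open>cond1\<close> and \<open>cond2\<close> needs no differentiation: if the hypersurface is \<open>f x = g y\<close>, then every
  slice through \<open>y\<close> is, near \<open>y\<close>, the level set of \<open>g\<close> at the value \<open>g y\<close>, so all these
  slices have the same curves and hence the same tangent space.

  For the converse, choose directions \<open>u\<close> and \<open>v\<close> in which the partial differentials do not
  vanish. By the implicit function theorem (\<open>implicit_along\<close>) there are continuously differentiable
  \<open>H\<close> and \<open>K\<close> such that, locally, the line through \<open>(p, q)\<close> in direction \<open>(0, v)\<close> meets the zero
  set exactly at the parameter \<open>H (p, q)\<close>, and the line in direction \<open>(u, 0)\<close> exactly at \<open>K (p, q)\<close>.
  Put \<open>g q = K (p0, q)\<close>: the level sets of \<open>g\<close> are the slices over the single line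
  \<open>p0 + t *\<^sub>R u\<close>. The condition \<open>cond1\<close> says that any other slice, over \<open>p\<close> say, is tangent at each of its
  points to the level set of \<open>g\<close> through that point. Since the slice over \<open>p\<close> is locally the
  image of a ball under \<open>q \<mapsto> q + H (p, q) *\<^sub>R v\<close>, the function \<open>g\<close> is constant on it; call the
  value \<open>f p\<close>. Conversely, if \<open>g q = f p\<close>, then \<open>q\<close> and \<open>q + H (p, q) *\<^sub>R v\<close> both lie on the
  slice over \<open>p0 + g q *\<^sub>R u\<close>, which meets a line in direction \<open>v\<close> only once, so
  \<open>H (p, q) = 0\<close> and \<open>q\<close> lies on the slice over \<open>p\<close>. This is \<open>separate_variables\<close>. The tangent
  hyperplanes form a merely continuous distribution; it is integrated without a uniqueness
  theorem because the slices over one line already foliate the second factor.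

  The implication from \<open>cond2\<close> to \<open>cond3\<close> is the one from \<open>cond1\<close> to \<open>cond3\<close> for the hypersurface with its two
  factors exchanged.
\<close>

section \<open>Continuously differentiable maps\<close>

text \<open>
  In finite dimension the derivative is continuous in operator norm as soon as it is continuous on
  each vector, so that derivatives can be handled as plain functions.
\<close>

lemma c1_onI:
  assumes "open S" "\<And>x. x \<in> S \<Longrightarrow> (f has_derivative f' x) (at x)"
    "\<And>v. continuous_on S (\<lambda>x. f' x v)"
  shows "c1_on f S"
  unfolding c1_on_def
proof (intro conjI exI ballI)
  have bl: "blinfun_apply (Blinfun (f' x)) = f' x" if "x \<in> S" for x
    using assms(2)[OF that] by (simp add: bounded_linear_Blinfun_apply has_derivative_bounded_linear)
  show "(f has_derivative blinfun_apply (Blinfun (f' x))) (at x)" if "x \<in> S" for x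
    using assms(2)[OF that] bl[OF that] by simp
  show "continuous_on S (\<lambda>x. Blinfun (f' x))"
    by (rule continuous_on_blinfun_componentwise)
      (use assms(3) bl in \<open>simp cong: continuous_on_cong\<close>)
qed (fact assms(1))

lemma c1_onE:
  assumes "c1_on f S"
  obtains f' where "open S" "\<And>x. x \<in> S \<Longrightarrow> (f has_derivative f' x) (at x)"
    "\<And>v. continuous_on S (\<lambda>x. f' x v)"
proof -
  from assms obtain f' where "open S"
    "\<forall>x\<in>S. (f has_derivative blinfun_apply (f' x)) (at x)" "continuous_on S f'"
    unfolding c1_on_def by blast
  then show thesis
    by (intro that[of "\<lambda>x. blinfun_apply (f' x)"]) (auto intro!: continuous_intros)
qed

lemma c1_on_imp_open: "c1_on f S \<Longrightarrow> open S"
  by (simp add: c1_on_def)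

lemma c1_on_has_derivative:
  "c1_on f S \<Longrightarrow> x \<in> S \<Longrightarrow> (f has_derivative frechet_derivative f (at x)) (at x)"
  by (metis c1_onE differentiableI frechet_derivative_works)

lemma c1_on_imp_continuous_on: "c1_on f S \<Longrightarrow> continuous_on S f"
  by (meson c1_on_has_derivative continuous_at_imp_continuous_on has_derivative_continuous)

lemma c1_on_subset: "c1_on f S \<Longrightarrow> open T \<Longrightarrow> T \<subseteq> S \<Longrightarrow> c1_on f T"
  unfolding c1_on_def by (blast intro: continuous_on_subset)

lemma c1_on_cong:
  assumes "c1_on f S" "\<And>x. x \<in> S \<Longrightarrow> f x = g x"
  shows "c1_on g S"
proof -
  from assms(1) obtain f' where f': "open S" "\<And>x. x \<in> S \<Longrightarrow> (f has_derivative f' x) (at x)"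
    "\<And>v. continuous_on S (\<lambda>x. f' x v)" by (rule c1_onE) blast
  show ?thesis
  proof (rule c1_onI[where f' = f'])
    show "(g has_derivative f' x) (at x)" if "x \<in> S" for x
      by (rule has_derivative_transform_within_open[OF f'(2)[OF that] f'(1) that])
        (simp add: assms(2))
  qed (use f' in auto)
qed

lemma c1_on_bounded_linear: "bounded_linear L \<Longrightarrow> open S \<Longrightarrow> c1_on L S"
  by (rule c1_onI[where f' = "\<lambda>_. L"])
    (auto intro: bounded_linear_imp_has_derivative)

lemma c1_on_const: "open S \<Longrightarrow> c1_on (\<lambda>_. c) S"
  by (rule c1_onI[where f' = "\<lambda>_ _. 0"]) auto

lemma c1_on_compose:
  assumes "c1_on f S" "c1_on g T" "f ` S \<subseteq> T"
  shows "c1_on (\<lambda>x. g (f x)) S"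
proof -
  from assms(1) obtain f' where f': "open S"
    "\<And>x. x \<in> S \<Longrightarrow> (f has_derivative blinfun_apply (f' x)) (at x)" "continuous_on S f'"
    unfolding c1_on_def by blast
  from assms(2) obtain g' where g':
    "\<And>x. x \<in> T \<Longrightarrow> (g has_derivative blinfun_apply (g' x)) (at x)" "continuous_on T g'"
    unfolding c1_on_def by blast
  have "continuous_on S (\<lambda>x. g' (f x))"
    using continuous_on_compose2[OF g'(2) c1_on_imp_continuous_on[OF assms(1)] assms(3)] .
  then have "continuous_on S (\<lambda>x. g' (f x) o\<^sub>L f' x)"
    using f'(3) by (intro continuous_intros)
  moreover have "((\<lambda>x. g (f x)) has_derivative blinfun_apply (g' (f x) o\<^sub>L f' x)) (at x)" if "x \<in> S" for x
  proof -
    have "f x \<in> T" using assms(3) that by blast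
    from has_derivative_compose[OF f'(2)[OF that] g'(1)[OF this]]
    show ?thesis by (simp add: blinfun_compose.rep_eq o_def)
  qed
  ultimately show ?thesis
    unfolding c1_on_def using f'(1) by (intro conjI exI[of _ "\<lambda>x. g' (f x) o\<^sub>L f' x"]) auto
qed

lemma c1_on_Pair:
  assumes "c1_on f S" "c1_on g S"
  shows "c1_on (\<lambda>x. (f x, g x)) S"
proof -
  from assms(1) obtain f' where f': "open S" "\<And>x. x \<in> S \<Longrightarrow> (f has_derivative f' x) (at x)"
    "\<And>v. continuous_on S (\<lambda>x. f' x v)" by (rule c1_onE) blast
  from assms(2) obtain g' where g': "\<And>x. x \<in> S \<Longrightarrow> (g has_derivative g' x) (at x)"
    "\<And>v. continuous_on S (\<lambda>x. g' x v)" by (rule c1_onE) blast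
  show ?thesis
    by (rule c1_onI[where f' = "\<lambda>x v. (f' x v, g' x v)"])
      (auto intro!: f' g' has_derivative_Pair continuous_intros)
qed

lemma c1_on_add:
  fixes f g :: "'a::euclidean_space \<Rightarrow> 'b::euclidean_space"
  assumes "c1_on f S" "c1_on g S"
  shows "c1_on (\<lambda>x. f x + g x) S"
proof -
  have "bounded_linear (\<lambda>p::'b \<times> 'b. fst p + snd p)"
    by (intro bounded_linear_add bounded_linear_fst bounded_linear_snd)
  from c1_on_compose[OF c1_on_Pair[OF assms] c1_on_bounded_linear[OF this open_UNIV]]
  show ?thesis by simp
qed

lemma c1_on_scaleR_left:
  assumes "c1_on f S"
  shows "c1_on (\<lambda>x. f x *\<^sub>R v) S"
  using c1_on_compose[OF assms c1_on_bounded_linear[OF bounded_linear_scaleR_left open_UNIV]]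
  by simp

lemma c1_on_map_prod:
  assumes "c1_on f S" "c1_on g T"
  shows "c1_on (map_prod f g) (S \<times> T)"
proof -
  have o: "open (S \<times> T)" using assms by (simp add: c1_on_imp_open open_Times)
  have "c1_on (\<lambda>z. f (fst z)) (S \<times> T)" "c1_on (\<lambda>z. g (snd z)) (S \<times> T)"
    using c1_on_compose[OF c1_on_bounded_linear[OF bounded_linear_fst o] assms(1)]
      c1_on_compose[OF c1_on_bounded_linear[OF bounded_linear_snd o] assms(2)] by auto
  from c1_on_Pair[OF this] show ?thesis by (simp add: map_prod_def split_def)
qed

lemma bounded_linear_swap: "bounded_linear (prod.swap :: _ \<Rightarrow> 'a::real_normed_vector \<times> 'b::real_normed_vector)"
  unfolding prod.swap_def by (intro bounded_linear_Pair bounded_linear_snd bounded_linear_fst)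

lemma has_derivative_swap:
  assumes "(F has_derivative D) (at (p, q))"
  shows "((\<lambda>z. F (prod.swap z)) has_derivative (\<lambda>h. D (prod.swap h))) (at (q, p))"
  by (rule has_derivative_compose[OF bounded_linear_imp_has_derivative[OF bounded_linear_swap]])
    (use assms in simp)

lemma c1_on_vimage_open:
  "c1_on f S \<Longrightarrow> open T \<Longrightarrow> open {x \<in> S. f x \<in> T}"
  using continuous_open_preimage[of S f T] c1_on_imp_continuous_on[of f S] c1_on_imp_open[of f S]
  by (simp add: vimage_def Int_def)

lemma c1_on_nonzero_derivative_nearby:
  fixes f :: "'a::euclidean_space \<Rightarrow> real"
  assumes "c1_on f S" "x \<in> S" "(f has_derivative D) (at x)" "D u \<noteq> 0"
  obtains T where "x \<in> T" "T \<subseteq> S" "c1_on f T"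
    "\<And>y. y \<in> T \<Longrightarrow> frechet_derivative f (at y) u \<noteq> 0"
proof -
  from assms(1) obtain f' where f': "open S" "\<And>x. x \<in> S \<Longrightarrow> (f has_derivative f' x) (at x)"
    "\<And>v. continuous_on S (\<lambda>x. f' x v)" by (rule c1_onE) blast
  let ?T = "{y \<in> S. f' y u \<noteq> 0}"
  have "open ?T"
    using continuous_open_preimage[OF f'(3) f'(1), of "- {0}" u]
    by (simp add: vimage_def Int_def open_Compl)
  moreover have "f' x = D"
    using f'(2)[OF assms(2)] assms(3) by (rule has_derivative_unique)
  moreover have "frechet_derivative f (at y) = f' y" if "y \<in> S" for y
    using frechet_derivative_at[OF f'(2)[OF that]] by simp
  ultimately show thesis
    using assms by (intro that[of ?T]) (auto intro: c1_on_subset)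
qed

section \<open>An implicit function theorem\<close>

text \<open>
  The inverse function theorem applies to \<open>(z, s) \<mapsto> (z, F (z + s *\<^sub>R d))\<close>. Solving along a
  direction \<open>d\<close> of the ambient space, instead of for a coordinate, makes one statement serve both
  factors of a product and avoids the choice of a complement of \<open>d\<close>.
\<close>

lemma implicit_along:
  fixes F :: "'a::euclidean_space \<Rightarrow> real"
  assumes F: "c1_on F \<Omega>" and z0: "z0 \<in> \<Omega>" "F z0 = 0"
    and F0: "(F has_derivative F0) (at z0)" "F0 d \<noteq> 0"
  obtains A \<delta> H where "z0 \<in> A" "\<delta> > 0" "c1_on H A" "H z0 = 0"
    "(H has_derivative (\<lambda>h. - F0 h / F0 d)) (at z0)"
    "\<And>z. z \<in> A \<Longrightarrow> \<bar>H z\<bar> < \<delta>"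
    "\<And>z s. z \<in> A \<Longrightarrow> \<bar>s\<bar> < \<delta> \<Longrightarrow> z + s *\<^sub>R d \<in> \<Omega>"
    "\<And>z s. z \<in> A \<Longrightarrow> \<bar>s\<bar> < \<delta> \<Longrightarrow> F (z + s *\<^sub>R d) = 0 \<longleftrightarrow> s = H z"
proof -
  from F obtain F' where F': "open \<Omega>"
    "\<And>x. x \<in> \<Omega> \<Longrightarrow> (F has_derivative F' x) (at x)"
    "\<And>v. continuous_on \<Omega> (\<lambda>x. F' x v)" by (rule c1_onE) blast
  have F0_eq: "F' z0 = F0"
    using F'(2)[OF z0(1)] F0(1) by (rule has_derivative_unique)
  define \<Omega>1 where "\<Omega>1 = {z \<in> \<Omega>. F' z d \<noteq> 0}"
  have \<Omega>1: "open \<Omega>1" "z0 \<in> \<Omega>1" "\<Omega>1 \<subseteq> \<Omega>"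
    using continuous_open_preimage[OF F'(3) F'(1), of "- {0}" d] F0(2) z0 F0_eq
    by (auto simp: vimage_def Int_def \<Omega>1_def open_Compl)
  define m :: "'a \<times> real \<Rightarrow> 'a" where "m = (\<lambda>w. fst w + snd w *\<^sub>R d)"
  have m_bl: "bounded_linear m"
    unfolding m_def by (intro bounded_linear_add bounded_linear_fst
        bounded_linear_compose[OF bounded_linear_scaleR_left bounded_linear_snd])
  define U where "U = m -` \<Omega>1"
  have "open U" unfolding U_def
    using \<Omega>1(1) m_bl by (intro open_vimage) (auto intro: linear_continuous_on)
  define \<Phi> where "\<Phi> = (\<lambda>w. (fst w, F (m w)))"
  have "c1_on \<Phi> U"
    unfolding \<Phi>_def
    by (intro c1_on_Pair c1_on_bounded_linear bounded_linear_fst \<open>open U\<close>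
        c1_on_compose[OF c1_on_bounded_linear[OF m_bl \<open>open U\<close>] F])
      (use \<Omega>1(3) in \<open>auto simp: U_def\<close>)
  then obtain \<Phi>' where \<Phi>': "\<And>x. x \<in> U \<Longrightarrow> (\<Phi> has_derivative blinfun_apply (\<Phi>' x)) (at x)"
    "continuous_on U \<Phi>'"
    unfolding c1_on_def by blast
  have \<Phi>'_eq: "blinfun_apply (\<Phi>' w) = (\<lambda>h. (fst h, F' (m w) (m h)))" if "w \<in> U" for w
  proof (rule has_derivative_unique[OF \<Phi>'(1)[OF that]])
    have "m w \<in> \<Omega>" using that \<Omega>1(3) by (auto simp: U_def)
    show "(\<Phi> has_derivative (\<lambda>h. (fst h, F' (m w) (m h)))) (at w)"
      unfolding \<Phi>_def
      by (intro has_derivative_Pair bounded_linear_imp_has_derivative bounded_linear_fst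
          has_derivative_compose[OF bounded_linear_imp_has_derivative[OF m_bl] F'(2)]
          \<open>m w \<in> \<Omega>\<close>)
  qed
  have z0U: "(z0, 0) \<in> U" using \<Omega>1(2) by (simp add: U_def m_def)
  have lF0: "bounded_linear F0" using F0(1) by (rule has_derivative_bounded_linear)
  define J :: "'a \<times> real \<Rightarrow> 'a \<times> real"
    where "J = (\<lambda>w. (fst w, (snd w - F0 (fst w)) / F0 d))"
  have J_bl: "bounded_linear J"
    unfolding J_def
    by (intro bounded_linear_Pair bounded_linear_fst bounded_linear_snd bounded_linear_sub
        bounded_linear_divide[THEN bounded_linear_compose]
        bounded_linear_compose[OF lF0 bounded_linear_fst])
  have J_apply: "blinfun_apply (Blinfun J) w = J w" for w
    using J_bl by (simp add: bounded_linear_Blinfun_apply)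
  \<comment> \<open>\<open>J\<close> is the inverse of the derivative of \<open>\<Phi>\<close> at the base point.\<close>
  have "Blinfun J o\<^sub>L \<Phi>' (z0, 0) = id_blinfun"
  proof (rule blinfun_eqI)
    fix h
    have "F0 (m h) = F0 (fst h) + snd h * F0 d"
      unfolding m_def using lF0 by (simp add: linear_simps)
    then show "blinfun_apply (Blinfun J o\<^sub>L \<Phi>' (z0, 0)) h = blinfun_apply id_blinfun h"
      using \<Phi>'_eq[OF z0U] F0_eq F0(2)
      by (simp add: J_apply) (simp add: J_def m_def)
  qed
  from inverse_function_theorem[OF \<open>open U\<close> \<Phi>' z0U this]
  obtain U' V G G' where inv: "open U'" "U' \<subseteq> U" "(z0, 0) \<in> U'" "open V" "\<Phi> (z0, 0) \<in> V"
    "homeomorphism U' V \<Phi> G" "\<And>y. y \<in> V \<Longrightarrow> (G has_derivative G' y) (at y)" by metis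
  have \<Phi>0: "\<Phi> (z0, 0) = (z0, 0)" using z0 by (simp add: \<Phi>_def m_def)
  have G: "\<And>w. w \<in> V \<Longrightarrow> G w \<in> U'" "\<And>w. w \<in> V \<Longrightarrow> \<Phi> (G w) = w"
    "\<And>w. w \<in> U' \<Longrightarrow> G (\<Phi> w) = w" "continuous_on V G"
    using inv(6) by (auto simp: homeomorphism_def)
  obtain A0 D where A0: "open A0" "open D" "z0 \<in> A0" "0 \<in> D" "A0 \<times> D \<subseteq> U'"
    by (rule open_prod_elim[OF inv(1,3)]) auto
  then obtain \<delta> where \<delta>: "\<delta> > 0" "ball 0 \<delta> \<subseteq> D" by (meson open_contains_ball)
  define H where "H = (\<lambda>z. snd (G (z, 0)))"
  define A where "A = (\<lambda>z. (z, 0::real)) -` {w \<in> V. G w \<in> A0 \<times> ball 0 \<delta>}"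
  have "open {w \<in> V. G w \<in> A0 \<times> ball 0 \<delta>}"
    using continuous_open_preimage[OF G(4) inv(4), of "A0 \<times> ball 0 \<delta>"] A0
    by (simp add: open_Times vimage_def Int_def)
  then have "open A" unfolding A_def
    by (intro open_vimage continuous_intros)
  have G0: "G (z0, 0) = (z0, 0)" using G(3)[OF inv(3)] \<Phi>0 by simp
  then have "z0 \<in> A" "H z0 = 0"
    using inv(5) \<Phi>0 A0(3) \<delta> by (auto simp: A_def H_def)
  have GH: "G (z, 0) = (z, H z)" if "z \<in> A" for z
    using G(2)[of "(z,0)"] that by (auto simp: A_def H_def \<Phi>_def prod_eq_iff)
  have zA0: "z \<in> A0" "\<bar>H z\<bar> < \<delta>" if "z \<in> A" for z
    using GH[OF that] that by (auto simp: A_def)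
  have box: "(z, s) \<in> U'" if "z \<in> A" "\<bar>s\<bar> < \<delta>" for z s
    using zA0(1)[OF that(1)] that(2) \<delta>(2) A0(5) by (auto simp: subset_iff)
  then have in\<Omega>1: "z + s *\<^sub>R d \<in> \<Omega>1" if "z \<in> A" "\<bar>s\<bar> < \<delta>" for z s
    using that inv(2) by (force simp: U_def m_def)
  have HF: "F (z + H z *\<^sub>R d) = 0" if "z \<in> A" for z
    using G(2)[of "(z,0)"] GH[OF that] that by (auto simp: A_def \<Phi>_def m_def)
  have uniq: "s = H z" if "z \<in> A" "\<bar>s\<bar> < \<delta>" "F (z + s *\<^sub>R d) = 0" for z s
    using G(3)[OF box[OF that(1,2)]] GH[OF that(1)] that(3) by (simp add: \<Phi>_def m_def)
  \<comment> \<open>Differentiating \<open>F (z + H z *\<^sub>R d) = 0\<close> gives an explicit formula for the derivative of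
    \<open>H\<close>, from which its continuity can be read off.\<close>
  define H' where "H' = (\<lambda>z h. - F' (z + H z *\<^sub>R d) h / F' (z + H z *\<^sub>R d) d)"
  have H': "(H has_derivative H' z) (at z)" if "z \<in> A" for z
  proof -
    have "(z, 0) \<in> V" using that by (simp add: A_def)
    have "((\<lambda>z. (z, 0::real)) has_derivative (\<lambda>h. (h, 0))) (at z)"
      by (intro has_derivative_Pair has_derivative_ident has_derivative_const)
    from has_derivative_snd[OF has_derivative_compose[OF this inv(7)[OF \<open>(z, 0) \<in> V\<close>]]]
    have "(H has_derivative (\<lambda>h. snd (G' (z, 0) (h, 0)))) (at z)"
      unfolding H_def .
    then obtain L where L: "(H has_derivative L) (at z)" by blast
    have in\<Omega>: "z + H z *\<^sub>R d \<in> \<Omega>1" using in\<Omega>1 that zA0 by simp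
    then have D: "(F has_derivative F' (z + H z *\<^sub>R d)) (at (z + H z *\<^sub>R d))"
      using F'(2) \<Omega>1(3) by blast
    have "((\<lambda>y. y + H y *\<^sub>R d) has_derivative (\<lambda>h. h + L h *\<^sub>R d)) (at z)"
      by (auto intro!: derivative_eq_intros L)
    from has_derivative_compose[OF this D]
    have "((\<lambda>y. F (y + H y *\<^sub>R d)) has_derivative
        (\<lambda>h. F' (z + H z *\<^sub>R d) (h + L h *\<^sub>R d))) (at z)" .
    moreover have "((\<lambda>y. F (y + H y *\<^sub>R d)) has_derivative (\<lambda>h. 0)) (at z)"
      by (rule has_derivative_transform_within_open[OF has_derivative_const[of 0] \<open>open A\<close> that])
        (simp add: HF)
    ultimately have eq: "(\<lambda>h. F' (z + H z *\<^sub>R d) (h + L h *\<^sub>R d)) = (\<lambda>h. 0)"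
      by (rule has_derivative_unique)
    have "L h = H' z h" for h
    proof -
      have "F' (z + H z *\<^sub>R d) (h + L h *\<^sub>R d) = 0" using fun_cong[OF eq] by simp
      then have "F' (z + H z *\<^sub>R d) h + L h * F' (z + H z *\<^sub>R d) d = 0"
        using has_derivative_bounded_linear[OF D] by (simp add: linear_simps)
      moreover have "F' (z + H z *\<^sub>R d) d \<noteq> 0" using in\<Omega> by (simp add: \<Omega>1_def)
      ultimately show ?thesis by (simp add: H'_def field_simps)
    qed
    then have "L = H' z" by auto
    then show ?thesis using L by simp
  qed
  have "c1_on H A"
  proof (rule c1_onI[OF \<open>open A\<close> H'])
    fix v
    have contH: "continuous_on A H"
      using H' by (meson continuous_at_imp_continuous_on has_derivative_continuous)
    have cont: "continuous_on A (\<lambda>z. F' (z + H z *\<^sub>R d) w)" for w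
      by (rule continuous_on_compose2[OF F'(3)])
        (use in\<Omega>1 \<Omega>1(3) zA0 contH in \<open>auto intro!: continuous_intros\<close>)
    show "continuous_on A (\<lambda>x. H' x v)"
      unfolding H'_def
      by (intro continuous_intros cont) (use in\<Omega>1 zA0 in \<open>auto simp: \<Omega>1_def\<close>)
  qed
  have "H' z0 = (\<lambda>h. - F0 h / F0 d)"
    using \<open>H z0 = 0\<close> F0_eq by (auto simp: H'_def)
  then have H_der: "(H has_derivative (\<lambda>h. - F0 h / F0 d)) (at z0)"
    using H'[OF \<open>z0 \<in> A\<close>] by simp
  show thesis
  proof (rule that[OF \<open>z0 \<in> A\<close> \<delta>(1) \<open>c1_on H A\<close> \<open>H z0 = 0\<close> H_der zA0(2)])
    show "z + s *\<^sub>R d \<in> \<Omega>" if "z \<in> A" "\<bar>s\<bar> < \<delta>" for z s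
      using in\<Omega>1[OF that] \<Omega>1(3) by blast
    show "F (z + s *\<^sub>R d) = 0 \<longleftrightarrow> s = H z" if "z \<in> A" "\<bar>s\<bar> < \<delta>" for z s
      using uniq[OF that] HF[OF that(1)] by blast
  qed
qed

section \<open>Separation of variables\<close>

text \<open>
  The hypothesis \<open>tangent\<close> expresses through curves that the tangent space of the slice over \<open>p\<close> at
  \<open>q\<close> is contained in that of the slice over \<open>p'\<close>: the initial velocity of a curve in the first slice
  is also that of a curve in the second. The argument is the one sketched at the beginning; the
  directions \<open>u\<close> and \<open>v\<close> are kept in the conclusion because they witness that \<open>f\<close> and \<open>g\<close> are
  submersions.
\<close>

lemma separate_variables:
  fixes F :: "'e::euclidean_space \<times> 'f::euclidean_space \<Rightarrow> real"
  assumes F: "c1_on F \<Omega>" and pq0: "(p0, q0) \<in> \<Omega>" "F (p0, q0) = 0"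
    and F0: "(F has_derivative F0) (at (p0, q0))" "F0 (u, 0) \<noteq> 0" "F0 (0, v) \<noteq> 0"
    and tangent: "\<And>p p' q c I. (p, q) \<in> \<Omega> \<Longrightarrow> (p', q) \<in> \<Omega> \<Longrightarrow> F (p, q) = 0 \<Longrightarrow> F (p', q) = 0 \<Longrightarrow>
      c (0::real) = q \<Longrightarrow> 0 \<in> I \<Longrightarrow> c1_on c I \<Longrightarrow>
      (\<And>t. t \<in> I \<Longrightarrow> (p, c t) \<in> \<Omega> \<and> F (p, c t) = 0) \<Longrightarrow>
      \<exists>c'. (c' has_vector_derivative vector_derivative c (at 0)) (at 0) \<and> c' 0 = q \<and>
        (\<forall>\<^sub>F t in nhds 0. (p', c' t) \<in> \<Omega> \<longrightarrow> F (p', c' t) = 0)"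
  obtains A B and f :: "'e \<Rightarrow> real" and g :: "'f \<Rightarrow> real"
    where "p0 \<in> A" "q0 \<in> B" "A \<times> B \<subseteq> \<Omega>" "c1_on f A" "c1_on g B"
    "\<And>p. p \<in> A \<Longrightarrow> frechet_derivative f (at p) u \<noteq> 0"
    "\<And>q. q \<in> B \<Longrightarrow> frechet_derivative g (at q) v \<noteq> 0"
    "\<And>p q. p \<in> A \<Longrightarrow> q \<in> B \<Longrightarrow> F (p, q) = 0 \<longleftrightarrow> f p = g q"
proof -
  obtain C \<delta> H where H: "(p0, q0) \<in> C" "\<delta> > 0" "c1_on H C" "H (p0, q0) = 0"
    "(H has_derivative (\<lambda>h. - F0 h / F0 (0, v))) (at (p0, q0))"
    "\<And>z. z \<in> C \<Longrightarrow> \<bar>H z\<bar> < \<delta>"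
    "\<And>z s. z \<in> C \<Longrightarrow> \<bar>s\<bar> < \<delta> \<Longrightarrow> z + s *\<^sub>R (0, v) \<in> \<Omega>"
    "\<And>z s. z \<in> C \<Longrightarrow> \<bar>s\<bar> < \<delta> \<Longrightarrow> F (z + s *\<^sub>R (0, v)) = 0 \<longleftrightarrow> s = H z"
    by (rule implicit_along[OF F pq0 F0(1,3)]) blast
  obtain E \<epsilon> K where K: "(p0, q0) \<in> E" "\<epsilon> > 0" "c1_on K E" "K (p0, q0) = 0"
    "(K has_derivative (\<lambda>h. - F0 h / F0 (u, 0))) (at (p0, q0))"
    "\<And>z. z \<in> E \<Longrightarrow> \<bar>K z\<bar> < \<epsilon>"
    "\<And>z s. z \<in> E \<Longrightarrow> \<bar>s\<bar> < \<epsilon> \<Longrightarrow> z + s *\<^sub>R (u, 0) \<in> \<Omega>"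
    "\<And>z s. z \<in> E \<Longrightarrow> \<bar>s\<bar> < \<epsilon> \<Longrightarrow> F (z + s *\<^sub>R (u, 0)) = 0 \<longleftrightarrow> s = K z"
    by (rule implicit_along[OF F pq0 F0(1,2)]) blast
  note open_C = c1_on_imp_open[OF H(3)] and open_E = c1_on_imp_open[OF K(3)]
  have affine_c1: "c1_on (\<lambda>q. (p, q)) S" if "open S" for p :: 'e and S :: "'f set"
    using that by (intro c1_on_Pair c1_on_const c1_on_bounded_linear[of "\<lambda>q. q"]) auto
  have affine_c1': "c1_on (\<lambda>p. (p, q)) S" if "open S" for q :: 'f and S :: "'e set"
    using that by (intro c1_on_Pair c1_on_const c1_on_bounded_linear[of "\<lambda>q. q"]) auto

  define B0 where "B0 = {q. (p0, q) \<in> E}"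
  define g where "g = (\<lambda>q. K (p0, q))"
  have "open B0"
    using open_vimage[OF open_E, of "\<lambda>q. (p0, q)"]
    by (simp add: B0_def vimage_def continuous_on_Pair)
  have g_c1: "c1_on g B0"
    unfolding g_def
    by (rule c1_on_compose[OF affine_c1[OF \<open>open B0\<close>] K(3)]) (auto simp: B0_def)
  define move where "move = (\<lambda>z. snd z + H z *\<^sub>R v)"
  have move_c1: "c1_on move C"
    unfolding move_def
    by (intro c1_on_add c1_on_bounded_linear bounded_linear_snd open_C c1_on_scaleR_left H(3))
  define R where "R = {z \<in> C. move z \<in> B0}"
  have "open R" "(p0, q0) \<in> R"
    using c1_on_vimage_open[OF move_c1 \<open>open B0\<close>] H(1,4) K(1)
    by (auto simp: R_def move_def B0_def)
  then obtain A1 B1 where AB1: "open A1" "open B1" "p0 \<in> A1" "q0 \<in> B1" "A1 \<times> B1 \<subseteq> R"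
    by (rule open_prod_elim) auto
  then obtain r where r: "r > 0" "ball q0 r \<subseteq> B1" by (meson open_contains_ball)
  have box: "(p, q) \<in> C" "move (p, q) \<in> B0" if "p \<in> A1" "q \<in> ball q0 r" for p q
    using subsetD[OF AB1(5), of "(p, q)"] subsetD[OF r(2) that(2)] that(1) by (auto simp: R_def)
  have on_zero: "(p, move (p, q)) \<in> \<Omega>" "F (p, move (p, q)) = 0" if "(p, q) \<in> C" for p q
    using H(6)[OF that] H(7,8)[OF that, of "H (p, q)"] by (auto simp: move_def)
  have g_zero: "(p0 + g q *\<^sub>R u, q) \<in> \<Omega>" "F (p0 + g q *\<^sub>R u, q) = 0" if "q \<in> B0" for q
    using that K(6)[of "(p0, q)"] K(7,8)[of "(p0, q)" "g q"] by (auto simp: B0_def g_def)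

  \<comment> \<open>On each slice the function \<open>g\<close> is constant: a curve in the slice over \<open>p\<close> has the same
    velocity as a curve in the slice over \<open>p0 + t *\<^sub>R u\<close>, on which \<open>g\<close> has the constant
    value \<open>t\<close>.\<close>
  have const: "g (move (p, q)) = g (move (p, q0))" if p: "p \<in> A1" and q: "q \<in> ball q0 r" for p q
  proof (rule has_derivative_zero_unique[OF convex_ball _ q])
    show "q0 \<in> ball q0 r" using r by simp
    fix q1 assume q1: "q1 \<in> ball q0 r"
    have mp: "c1_on (\<lambda>q. move (p, q)) (ball q0 r)"
      by (rule c1_on_compose[OF affine_c1[OF open_ball] move_c1]) (use box p in auto)
    have "c1_on (\<lambda>q. g (move (p, q))) (ball q0 r)"
      by (rule c1_on_compose[OF mp g_c1]) (use box p in auto)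
    from c1_on_has_derivative[OF this q1] obtain D
      where D: "((\<lambda>q. g (move (p, q))) has_derivative D) (at q1)" by blast
    have "D w = 0" for w
    proof -
      define I where "I = (\<lambda>t. q1 + t *\<^sub>R w) -` ball q0 r"
      have I: "open I" "0 \<in> I"
        using q1 by (auto simp: I_def intro!: open_vimage continuous_intros)
      define c where "c = (\<lambda>t::real. move (p, q1 + t *\<^sub>R w))"
      have line: "c1_on (\<lambda>t. q1 + t *\<^sub>R w) I"
        using I by (intro c1_on_add c1_on_const c1_on_scaleR_left c1_on_bounded_linear) auto
      have c_c1: "c1_on c I"
        unfolding c_def by (rule c1_on_compose[OF line mp]) (auto simp: I_def)
      define t where "t = g (c 0)"
      have c0: "c 0 = move (p, q1)" "c 0 \<in> B0" using box p q1 by (auto simp: c_def)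
      have "\<exists>c'. (c' has_vector_derivative vector_derivative c (at 0)) (at 0) \<and> c' 0 = c 0 \<and>
        (\<forall>\<^sub>F s in nhds 0. (p0 + t *\<^sub>R u, c' s) \<in> \<Omega> \<longrightarrow> F (p0 + t *\<^sub>R u, c' s) = 0)"
      proof (rule tangent[of p "c 0" "p0 + t *\<^sub>R u" c I])
        show "(p, c 0) \<in> \<Omega>" "F (p, c 0) = 0"
          using on_zero box(1) p q1 c0 by auto
        show "(p0 + t *\<^sub>R u, c 0) \<in> \<Omega>" "F (p0 + t *\<^sub>R u, c 0) = 0"
          using g_zero c0 by (auto simp: t_def)
        show "(p, c s) \<in> \<Omega> \<and> F (p, c s) = 0" if "s \<in> I" for s
          using that on_zero box(1) p by (auto simp: c_def I_def)
      qed (use I c_c1 in auto)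
      then obtain c' where c': "(c' has_vector_derivative vector_derivative c (at 0)) (at 0)"
        "c' 0 = c 0" "\<forall>\<^sub>F s in nhds 0. (p0 + t *\<^sub>R u, c' s) \<in> \<Omega> \<longrightarrow> F (p0 + t *\<^sub>R u, c' s) = 0"
        by blast
      have "isCont c' 0" using c'(1) by (rule has_vector_derivative_continuous)
      then have "(c' \<longlongrightarrow> c 0) (at 0)" using c'(2) by (simp add: isCont_def)
      then have ev: "\<forall>\<^sub>F s in nhds 0. c' s \<in> B0"
        using topological_tendstoD[OF _ \<open>open B0\<close> c0(2)] c0(2) c'(2)
        by (simp add: eventually_nhds_conv_at)
      have "\<bar>t\<bar> < \<epsilon>" using K(6) c0(2) by (auto simp: t_def g_def B0_def)
      have "\<forall>\<^sub>F s in nhds 0. g (c' s) = t"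
        using ev c'(3)
      proof eventually_elim
        case (elim s)
        then show ?case
          using K(7,8)[OF _ \<open>\<bar>t\<bar> < \<epsilon>\<close>, of "(p0, c' s)"] by (auto simp: g_def B0_def)
      qed
      then have zero: "((\<lambda>s. g (c' s)) has_derivative (\<lambda>h. 0)) (at 0)"
        using has_derivative_transform_eventually[OF has_derivative_const[of t "at (0::real)"], of "\<lambda>s. g (c' s)"]
        by (auto simp: eventually_nhds_conv_at eq_commute)
      obtain G where G: "(g has_derivative G) (at (c 0))"
        using c1_on_has_derivative[OF g_c1 c0(2)] by blast
      have cd: "(c has_vector_derivative vector_derivative c (at 0)) (at 0)"
        using c1_on_has_derivative[OF c_c1 I(2)]
        by (metis differentiableI vector_derivative_works)
      have "G (1 *\<^sub>R vector_derivative c (at 0)) = 0"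
        using has_derivative_unique[OF zero has_derivative_compose[OF c'(1)[unfolded has_vector_derivative_def], of g G]]
          G c'(2) by (metis (no_types))
      moreover have "((\<lambda>s. g (c s)) has_derivative (\<lambda>s. G (s *\<^sub>R vector_derivative c (at 0)))) (at 0)"
        using has_derivative_compose[OF cd[unfolded has_vector_derivative_def] G] .
      moreover have "((\<lambda>s. g (c s)) has_derivative (\<lambda>s. D (s *\<^sub>R w))) (at 0)"
        unfolding c_def
      proof (rule has_derivative_compose[where f = "\<lambda>s. q1 + s *\<^sub>R w"])
        show "((\<lambda>s. q1 + s *\<^sub>R w) has_derivative (\<lambda>s. s *\<^sub>R w)) (at 0)"
          by (auto intro!: derivative_eq_intros)
      qed (use D in simp)
      ultimately have "G (1 *\<^sub>R vector_derivative c (at 0)) = D (1 *\<^sub>R w)"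
        by (metis has_derivative_unique)
      then show ?thesis using \<open>G _ = 0\<close> by simp
    qed
    then have "D = (\<lambda>_. 0)" by auto
    then show "((\<lambda>q. g (move (p, q))) has_derivative (\<lambda>h. 0)) (at q1 within ball q0 r)"
      using D by (simp add: has_derivative_at_withinI)
  qed

  define f where "f = (\<lambda>p. g (move (p, q0)))"
  have "c1_on (\<lambda>p. move (p, q0)) A1"
    by (rule c1_on_compose[OF affine_c1'[OF \<open>open A1\<close>] move_c1]) (use box r in auto)
  then have f_c1: "c1_on f A1"
    unfolding f_def by (rule c1_on_compose[OF _ g_c1]) (use box r in auto)

  have lin: "bounded_linear F0" using F0(1) by (rule has_derivative_bounded_linear)
  have g_der: "(g has_derivative (\<lambda>h. - F0 (0, h) / F0 (u, 0))) (at q0)"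
  proof -
    have "((\<lambda>q. (p0, q)) has_derivative (\<lambda>h. (0, h))) (at q0)"
      by (intro has_derivative_Pair has_derivative_ident has_derivative_const)
    from has_derivative_compose[OF this K(5)] show ?thesis unfolding g_def .
  qed
  have H_der: "((\<lambda>p. H (p, q0)) has_derivative (\<lambda>h. - F0 (h, 0) / F0 (0, v))) (at p0)"
  proof -
    have "((\<lambda>p. (p, q0)) has_derivative (\<lambda>h. (h, 0))) (at p0)"
      by (intro has_derivative_Pair has_derivative_ident has_derivative_const)
    from has_derivative_compose[OF this H(5)] show ?thesis .
  qed
  have move_der:
    "((\<lambda>p. move (p, q0)) has_derivative (\<lambda>h. (- F0 (h, 0) / F0 (0, v)) *\<^sub>R v)) (at p0)"
    unfolding move_def by (auto intro!: derivative_eq_intros H_der)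
  have "move (p0, q0) = q0" using H(4) by (simp add: move_def)
  then have "(g has_derivative (\<lambda>h. - F0 (0, h) / F0 (u, 0))) (at (move (p0, q0)))"
    using g_der by simp
  from has_derivative_compose[OF move_der this] have f_der: "(f has_derivative
      (\<lambda>h. - F0 (0, (- F0 (h, 0) / F0 (0, v)) *\<^sub>R v) / F0 (u, 0))) (at p0)"
    unfolding f_def .
  \<comment> \<open>\<open>f\<close> and \<open>g\<close> are submersions at the base point; by continuity of the derivatives they
    are so in a neighbourhood.\<close>
  have f_ne: "- F0 (0, (- F0 (u, 0) / F0 (0, v)) *\<^sub>R v) / F0 (u, 0) \<noteq> 0"
    using linear_cmul[OF bounded_linear.linear[OF lin], of "- F0 (u, 0) / F0 (0, v)" "(0, v)"] F0(2,3) by simp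
  have q0B0: "q0 \<in> B0" using K(1) by (simp add: B0_def)
  obtain A where A: "p0 \<in> A" "A \<subseteq> A1" "c1_on f A"
    "\<And>p. p \<in> A \<Longrightarrow> frechet_derivative f (at p) u \<noteq> 0"
    by (rule c1_on_nonzero_derivative_nearby[OF f_c1 AB1(3) f_der f_ne]) blast
  obtain B2 where B2: "q0 \<in> B2" "B2 \<subseteq> B0" "c1_on g B2"
    "\<And>q. q \<in> B2 \<Longrightarrow> frechet_derivative g (at q) v \<noteq> 0"
    by (rule c1_on_nonzero_derivative_nearby[OF g_c1 q0B0 g_der, of v])
      (use F0(2,3) in auto)
  \<comment> \<open>The last condition makes \<open>H\<close> available at \<open>(p0 + g q *\<^sub>R u, q)\<close>, as the converse
    below requires.\<close>
  define B where "B = {q \<in> B2 \<inter> ball q0 r. (p0 + g q *\<^sub>R u, q) \<in> C}"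
  have "c1_on g (B2 \<inter> ball q0 r)"
    using B2(3) by (rule c1_on_subset) (auto intro: c1_on_imp_open[OF B2(3)])
  then have "c1_on (\<lambda>q. (p0 + g q *\<^sub>R u, q)) (B2 \<inter> ball q0 r)"
    by (intro c1_on_Pair c1_on_add c1_on_const c1_on_scaleR_left
        c1_on_bounded_linear[of "\<lambda>q. q"]) (auto intro: c1_on_imp_open[OF B2(3)])
  then have "open B"
    unfolding B_def using open_C by (rule c1_on_vimage_open)
  then have gB: "c1_on g B"
    using B2(3) by (auto intro: c1_on_subset simp: B_def)
  have "q0 \<in> B" using B2(1) r(1) K(4) H(1) by (simp add: B_def g_def)
  have sep: "F (p, q) = 0 \<longleftrightarrow> f p = g q" if p: "p \<in> A" and q: "q \<in> B" for p q
  proof -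
    have pq: "(p, q) \<in> C" "move (p, q) \<in> B0" and fp: "g (move (p, q)) = f p"
      using box const[of p q] p q A(2) by (auto simp: B_def f_def)
    have iff: "F (p, q) = 0 \<longleftrightarrow> H (p, q) = 0"
      using H(8)[OF pq(1), of 0] H(2) by auto
    show ?thesis
    proof
      assume "F (p, q) = 0"
      then show "f p = g q" using iff fp by (simp add: move_def)
    next
      assume eq: "f p = g q"
      have z: "(p0 + g q *\<^sub>R u, q) \<in> C" "q \<in> B0" using q B2(2) by (auto simp: B_def)
      \<comment> \<open>The line through \<open>q\<close> in direction \<open>v\<close> meets the zero set over
        \<open>p0 + g q *\<^sub>R u\<close> at \<open>q\<close> and at \<open>move (p, q)\<close>, but only once.\<close>
      have "0 = H (p0 + g q *\<^sub>R u, q)"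
        using H(8)[OF z(1), of 0] g_zero[OF z(2)] H(2) by simp
      moreover have "H (p, q) = H (p0 + g q *\<^sub>R u, q)"
        using H(8)[OF z(1), of "H (p, q)"] H(6)[OF pq(1)] g_zero[OF pq(2)] eq fp
        by (simp add: move_def)
      ultimately show "F (p, q) = 0" using iff by simp
    qed
  qed
  have AB: "A \<times> B \<subseteq> \<Omega>"
  proof safe
    fix p q assume "p \<in> A" "q \<in> B"
    then have "(p, q) \<in> C" using box A(2) by (auto simp: B_def)
    from H(7)[OF this, of 0] H(2) show "(p, q) \<in> \<Omega>" by simp
  qed
  have gB': "frechet_derivative g (at q) v \<noteq> 0" if "q \<in> B" for q
    using B2(4) that by (simp add: B_def)
  show thesis
    by (rule that[OF A(1) \<open>q0 \<in> B\<close> AB A(3) gB A(4) gB' sep])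
qed

section \<open>Charts, curves and velocities\<close>

lemma
  assumes "chart_on X (U, \<phi>)"
  shows chart_on_openin: "openin X U" and chart_on_open_image: "open (\<phi> ` U)"
    and chart_on_inj: "inj_on \<phi> U"
    and chart_on_open_map: "\<And>W. openin X W \<Longrightarrow> W \<subseteq> U \<Longrightarrow> open (\<phi> ` W)"
    and chart_on_continuous: "continuous_map (subtopology X U) euclidean \<phi>"
    and chart_on_continuous_inv: "continuous_map (top_of_set (\<phi> ` U)) X (inv_into U \<phi>)"
proof -
  from assms have U: "openin X U" "open (\<phi> ` U)"
    and h: "homeomorphic_map (subtopology X U) (top_of_set (\<phi> ` U)) \<phi>"
    by (auto simp: chart_on_def)
  have ts: "topspace (subtopology X U) = U"
    using openin_subset[OF U(1)] by auto
  show "openin X U" "open (\<phi> ` U)" by fact+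
  show inj: "inj_on \<phi> U"
    using homeomorphic_imp_injective_map[OF h] ts by simp
  show "open (\<phi> ` W)" if "openin X W" "W \<subseteq> U" for W
  proof -
    have "openin (subtopology X U) W"
      using that by (simp add: openin_open_subtopology U(1))
    then have "openin (top_of_set (\<phi> ` U)) (\<phi> ` W)"
      using homeomorphic_map_openness[OF h, of W] that ts by auto
    then show ?thesis using U(2) by (simp add: openin_open_eq)
  qed
  show "continuous_map (subtopology X U) euclidean \<phi>"
    using homeomorphic_imp_continuous_map[OF h] by (rule continuous_map_into_fulltopology)
  obtain g where g: "homeomorphic_maps (subtopology X U) (top_of_set (\<phi> ` U)) \<phi> g"
    using h by (auto simp: homeomorphic_map_maps)
  then have "continuous_map (top_of_set (\<phi> ` U)) (subtopology X U) g"
    and gf: "\<And>x. x \<in> U \<Longrightarrow> g (\<phi> x) = x"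
    using ts by (auto simp: homeomorphic_maps_def)
  then have "continuous_map (top_of_set (\<phi> ` U)) X g"
    by (simp add: continuous_map_into_fulltopology)
  then show "continuous_map (top_of_set (\<phi> ` U)) X (inv_into U \<phi>)"
    by (rule continuous_map_eq) (auto simp: gf inv_into_f_f[OF inj])
qed

lemma chart_on_openin_vimage:
  assumes "chart_on X (U, \<phi>)" "open T"
  shows "openin X {x \<in> U. \<phi> x \<in> T}"
proof -
  have "{x \<in> topspace (subtopology X U). \<phi> x \<in> T} = {x \<in> U. \<phi> x \<in> T}"
    using openin_subset[OF chart_on_openin[OF assms(1)]] by auto
  with openin_continuous_map_preimage[OF chart_on_continuous[OF assms(1)], of T] assms(2)
  have "openin (subtopology X U) {x \<in> U. \<phi> x \<in> T}" by (metis open_openin)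
  then show ?thesis
    using chart_on_openin[OF assms(1)] by (simp add: openin_open_subtopology)
qed

text \<open>
  The part of \<^const>\<open>c1_manifold\<close> that concerns charts. The arguments about curves are local, and
  this part passes to products, which carry the tangent spaces of the hypersurface.
\<close>

definition c1_charts :: "('a, 'e::euclidean_space) manifold \<Rightarrow> bool" where
  "c1_charts M \<longleftrightarrow>
     (\<forall>c\<in>atlas M. chart_on (mtop M) c) \<and>
     (\<Union>c\<in>atlas M. fst c) = topspace (mtop M) \<and>
     (\<forall>c\<in>atlas M. \<forall>d\<in>atlas M. c1_compatible c d)"

lemma c1_manifold_imp_c1_charts: "c1_manifold M \<Longrightarrow> c1_charts M"
  by (simp add: c1_manifold_def c1_charts_def)

lemma c1_charts_chart_on: "c1_charts M \<Longrightarrow> (U, \<phi>) \<in> atlas M \<Longrightarrow> chart_on (mtop M) (U, \<phi>)"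
  by (auto simp: c1_charts_def)

lemma c1_charts_transition:
  assumes "c1_charts M" "(U, \<phi>) \<in> atlas M" "(V, \<psi>) \<in> atlas M"
  shows "c1_on (\<lambda>z. \<psi> (inv_into U \<phi> z)) (\<phi> ` (U \<inter> V))"
  using assms by (fastforce simp: c1_charts_def c1_compatible_def o_def)

lemma c1_charts_obtain:
  assumes "c1_charts M" "x \<in> topspace (mtop M)"
  obtains U \<phi> where "(U, \<phi>) \<in> atlas M" "x \<in> U"
proof -
  have "x \<in> (\<Union>c\<in>atlas M. fst c)" using assms by (simp add: c1_charts_def)
  then show thesis using that by (metis UN_E prod.collapse)
qed

lemma chart_domain_in_topspace:
  assumes "c1_charts M" "(U, \<phi>) \<in> atlas M" "x \<in> U"
  shows "x \<in> topspace (mtop M)"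
  using openin_subset[OF chart_on_openin[OF c1_charts_chart_on[OF assms(1,2)]]] assms(3) by blast

lemma inv_into_UNIV_ident [simp]: "inv_into UNIV (\<lambda>x. x) = (\<lambda>x. x)"
  by (simp add: fun_eq_iff inv_f_eq)

lemma c1_map_on_from_euclidean_iff:
  "c1_map_on euclidean_manifold M S \<gamma> \<longleftrightarrow>
     open S \<and> continuous_map (top_of_set S) (mtop M) \<gamma> \<and>
     (\<forall>(W, \<psi>) \<in> atlas M. c1_on (\<lambda>t. \<psi> (\<gamma> t)) {t \<in> S. \<gamma> t \<in> W})"
  by (simp add: c1_map_on_def euclidean_manifold_def o_def)

text \<open>
  Since transition maps are continuously differentiable, one chart around the base point decides
  whether a curve is continuously differentiable; continuity in the topology of the manifold
  comes from the continuous inverse of that chart.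
\<close>

lemma c1_curve_at_iff_chart:
  assumes M: "c1_charts M" and U: "(U, \<phi>) \<in> atlas M" and x: "x \<in> U"
  shows "c1_curve_at M x \<gamma> \<longleftrightarrow>
    \<gamma> 0 = x \<and> (\<exists>I. 0 \<in> I \<and> (\<forall>t\<in>I. \<gamma> t \<in> U) \<and> c1_on (\<lambda>t. \<phi> (\<gamma> t)) I)"
    (is "?l \<longleftrightarrow> ?r")
proof
  assume ?l
  then obtain \<epsilon> where \<epsilon>: "\<gamma> 0 = x" "\<epsilon> > 0" "c1_map_on euclidean_manifold M {-\<epsilon><..<\<epsilon>} \<gamma>"
    by (auto simp: c1_curve_at_def)
  with U have "c1_on (\<lambda>t. \<phi> (\<gamma> t)) {t \<in> {-\<epsilon><..<\<epsilon>}. \<gamma> t \<in> U}"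
    by (fastforce simp: c1_map_on_from_euclidean_iff)
  with \<epsilon> x show ?r
    by (intro conjI exI[of _ "{t \<in> {-\<epsilon><..<\<epsilon>}. \<gamma> t \<in> U}"]) auto
next
  assume ?r
  then obtain I where I: "\<gamma> 0 = x" "0 \<in> I" "\<And>t. t \<in> I \<Longrightarrow> \<gamma> t \<in> U" "c1_on (\<lambda>t. \<phi> (\<gamma> t)) I"
    by blast
  obtain \<epsilon> where \<epsilon>: "\<epsilon> > 0" "ball 0 \<epsilon> \<subseteq> I"
    using c1_on_imp_open[OF I(4)] I(2) open_contains_ball by blast
  define J where "J = {-\<epsilon><..<\<epsilon>}"
  have J: "open J" "J \<subseteq> I" using \<epsilon>(2) by (auto simp: J_def ball_eq_greaterThanLessThan)
  note chart = c1_charts_chart_on[OF M U]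
  have c1: "c1_on (\<lambda>t. \<phi> (\<gamma> t)) J" using I(4) J by (rule c1_on_subset)
  have "continuous_map (top_of_set J) (top_of_set (\<phi> ` U)) (\<lambda>t. \<phi> (\<gamma> t))"
    using c1_on_imp_continuous_on[OF c1] I(3) J(2)
    by (auto simp: continuous_map_in_subtopology)
  from continuous_map_compose[OF this chart_on_continuous_inv[OF chart]]
  have cont: "continuous_map (top_of_set J) (mtop M) \<gamma>"
    by (rule continuous_map_eq) (use I(3) J(2) in \<open>auto simp: inv_into_f_f[OF chart_on_inj[OF chart]]\<close>)
  have "c1_on (\<lambda>t. \<psi> (\<gamma> t)) {t \<in> J. \<gamma> t \<in> W}" if W: "(W, \<psi>) \<in> atlas M" for W \<psi>
  proof -
    have "openin (mtop M) W" by (rule chart_on_openin[OF c1_charts_chart_on[OF M W]])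
    then have "openin (top_of_set J) {t \<in> J. \<gamma> t \<in> W}"
      using openin_continuous_map_preimage[OF cont] by simp
    then have "open {t \<in> J. \<gamma> t \<in> W}" using J(1) by (simp add: openin_open_eq)
    then have "c1_on (\<lambda>t. \<phi> (\<gamma> t)) {t \<in> J. \<gamma> t \<in> W}"
      using c1 by (auto intro: c1_on_subset)
    then have "c1_on (\<lambda>t. \<psi> (inv_into U \<phi> (\<phi> (\<gamma> t)))) {t \<in> J. \<gamma> t \<in> W}"
      by (rule c1_on_compose[OF _ c1_charts_transition[OF M U W]]) (use I(3) J(2) in auto)
    then show ?thesis
      by (rule c1_on_cong) (use I(3) J(2) in \<open>auto simp: inv_into_f_f[OF chart_on_inj[OF chart]]\<close>)
  qed
  with cont J(1) have "c1_map_on euclidean_manifold M J \<gamma>"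
    by (auto simp: c1_map_on_from_euclidean_iff)
  with I(1) \<epsilon>(1) show ?l by (auto simp: c1_curve_at_def J_def)
qed

lemma c1_curve_at_has_vector_derivative:
  assumes "c1_charts M" "(U, \<phi>) \<in> atlas M" "x \<in> U" "c1_curve_at M x \<gamma>"
  shows "((\<lambda>t. \<phi> (\<gamma> t)) has_vector_derivative vector_derivative (\<phi> \<circ> \<gamma>) (at 0)) (at 0)"
proof -
  obtain I where "0 \<in> I" "c1_on (\<lambda>t. \<phi> (\<gamma> t)) I"
    using assms by (auto simp: c1_curve_at_iff_chart)
  from c1_on_has_derivative[OF this(2,1)] show ?thesis
    unfolding o_def by (metis differentiableI vector_derivative_works)
qed

lemma c1_curve_at_0: "c1_curve_at M x \<gamma> \<Longrightarrow> \<gamma> 0 = x"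
  by (simp add: c1_curve_at_def)

lemma c1_curve_at_eventually_in:
  assumes "c1_curve_at M x \<gamma>" "openin (mtop M) V" "x \<in> V"
  shows "\<forall>\<^sub>F t in nhds 0. \<gamma> t \<in> V"
proof -
  obtain S where S: "0 \<in> S" "open S" "continuous_map (top_of_set S) (mtop M) \<gamma>"
  proof -
    obtain \<epsilon> :: real where "\<epsilon> > 0" "c1_map_on euclidean_manifold M {-\<epsilon><..<\<epsilon>} \<gamma>"
      using assms(1) by (auto simp: c1_curve_at_def)
    then show thesis
      by (intro that[of "{-\<epsilon><..<\<epsilon>}"]) (auto simp: c1_map_on_from_euclidean_iff)
  qed
  have "openin (top_of_set S) {t \<in> S. \<gamma> t \<in> V}"
    using openin_continuous_map_preimage[OF S(3) assms(2)] by simp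
  then have "open {t \<in> S. \<gamma> t \<in> V}" using S(2) by (simp add: openin_open_eq)
  moreover have "0 \<in> {t \<in> S. \<gamma> t \<in> V}"
    using S(1) assms(3) c1_curve_at_0[OF assms(1)] by simp
  ultimately have "\<forall>\<^sub>F t in nhds 0. t \<in> {t \<in> S. \<gamma> t \<in> V}"
    by (rule eventually_nhds_in_open)
  then show ?thesis by eventually_elim simp
qed

lemma c1_curve_at_lift:
  assumes M: "c1_charts M" and U: "(U, \<phi>) \<in> atlas M"
    and c: "c1_on c I" "0 \<in> I" "c ` I \<subseteq> \<phi> ` U"
  shows "c1_curve_at M (inv_into U \<phi> (c 0)) (\<lambda>t. inv_into U \<phi> (c t))"
proof -
  have inU: "inv_into U \<phi> (c t) \<in> U" and eq: "\<phi> (inv_into U \<phi> (c t)) = c t" if "t \<in> I" for t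
    using subsetD[OF c(3) imageI[OF that]] by (auto intro: inv_into_into f_inv_into_f)
  have "c1_on (\<lambda>t. \<phi> (inv_into U \<phi> (c t))) I"
    by (rule c1_on_cong[OF c(1)]) (simp add: eq)
  then show ?thesis
    unfolding c1_curve_at_iff_chart[OF M U inU[OF c(2)]] using c(2) inU by auto
qed

lemma c1_curve_at_with_velocity:
  assumes M: "c1_charts M" and U: "(U, \<phi>) \<in> atlas M" and x: "x \<in> U"
  obtains \<gamma> where "c1_curve_at M x \<gamma>" "vector_derivative (\<phi> \<circ> \<gamma>) (at 0) = v"
proof -
  note chart = c1_charts_chart_on[OF M U]
  define I where "I = (\<lambda>t::real. \<phi> x + t *\<^sub>R v) -` (\<phi> ` U)"
  have I: "open I" "0 \<in> I"
    using chart_on_open_image[OF chart] x by (auto simp: I_def intro!: open_vimage continuous_intros)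
  have "c1_on (\<lambda>t. \<phi> x + t *\<^sub>R v) I"
    using I(1) by (intro c1_on_add c1_on_const c1_on_scaleR_left c1_on_bounded_linear) auto
  then have 1: "c1_curve_at M x (\<lambda>t. inv_into U \<phi> (\<phi> x + t *\<^sub>R v))"
    using c1_curve_at_lift[OF M U _ I(2), of "\<lambda>t. \<phi> x + t *\<^sub>R v"] x
    by (auto simp: I_def inv_into_f_f[OF chart_on_inj[OF chart]])
  have "((\<lambda>t. \<phi> x + t *\<^sub>R v) has_vector_derivative v) (at 0)"
    by (auto intro!: derivative_eq_intros)
  then have "((\<phi> \<circ> (\<lambda>t. inv_into U \<phi> (\<phi> x + t *\<^sub>R v))) has_vector_derivative v) (at 0)"
    by (rule has_vector_derivative_transform_within_open[OF _ I])
      (auto simp: I_def f_inv_into_f)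
  then show thesis using 1 that vector_derivative_at by blast
qed

lemma vector_derivative_chart_change:
  assumes M: "c1_charts M" and U: "(U, \<phi>) \<in> atlas M" "x \<in> U" and V: "(V, \<psi>) \<in> atlas M" "x \<in> V"
  obtains D where "\<And>\<gamma>. c1_curve_at M x \<gamma> \<Longrightarrow>
    vector_derivative (\<psi> \<circ> \<gamma>) (at 0) = D (vector_derivative (\<phi> \<circ> \<gamma>) (at 0))"
proof -
  let ?\<tau> = "\<lambda>z. \<psi> (inv_into U \<phi> z)"
  note inj = chart_on_inj[OF c1_charts_chart_on[OF M U(1)]]
  have D: "(?\<tau> has_derivative frechet_derivative ?\<tau> (at (\<phi> x))) (at (\<phi> x))"
    by (rule c1_on_has_derivative[OF c1_charts_transition[OF M U(1) V(1)]]) (use U V in auto)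
  show thesis
  proof (rule that)
    fix \<gamma> assume \<gamma>: "c1_curve_at M x \<gamma>"
    obtain I where I: "0 \<in> I" "\<And>t. t \<in> I \<Longrightarrow> \<gamma> t \<in> U" "c1_on (\<lambda>t. \<phi> (\<gamma> t)) I"
      using \<gamma> c1_curve_at_iff_chart[OF M U] by auto
    have "((\<lambda>t. ?\<tau> (\<phi> (\<gamma> t))) has_derivative (\<lambda>h. frechet_derivative ?\<tau> (at (\<phi> x))
        (h *\<^sub>R vector_derivative (\<phi> \<circ> \<gamma>) (at 0)))) (at 0)"
      by (rule has_derivative_compose[OF c1_curve_at_has_vector_derivative[OF M U \<gamma>, unfolded has_vector_derivative_def]])
        (use D c1_curve_at_0[OF \<gamma>] in simp)
    then have "((\<lambda>t. ?\<tau> (\<phi> (\<gamma> t))) has_vector_derivative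
        frechet_derivative ?\<tau> (at (\<phi> x)) (vector_derivative (\<phi> \<circ> \<gamma>) (at 0))) (at 0)"
      using linear_cmul[OF has_derivative_linear[OF D]] by (simp add: has_vector_derivative_def)
    then have "((\<psi> \<circ> \<gamma>) has_vector_derivative
        frechet_derivative ?\<tau> (at (\<phi> x)) (vector_derivative (\<phi> \<circ> \<gamma>) (at 0))) (at 0)"
      by (rule has_vector_derivative_transform_within_open[OF _ c1_on_imp_open[OF I(3)] I(1)])
        (simp add: I(2) inv_into_f_f[OF inj])
    then show "vector_derivative (\<psi> \<circ> \<gamma>) (at 0) =
        frechet_derivative ?\<tau> (at (\<phi> x)) (vector_derivative (\<phi> \<circ> \<gamma>) (at 0))"
      by (rule vector_derivative_at)
  qed
qed

text \<open>
  A velocity is determined by its representation in a single chart, because the representation in any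
  other chart is the image under the derivative of the transition map.
\<close>

lemma mem_velocity_iff:
  assumes M: "c1_charts M" and U: "(U, \<phi>) \<in> atlas M" "x \<in> U" and \<gamma>: "c1_curve_at M x \<gamma>"
  shows "\<delta> \<in> velocity M \<gamma> \<longleftrightarrow> c1_curve_at M x \<delta> \<and>
    vector_derivative (\<phi> \<circ> \<delta>) (at 0) = vector_derivative (\<phi> \<circ> \<gamma>) (at 0)"
proof
  assume "\<delta> \<in> velocity M \<gamma>"
  then show "c1_curve_at M x \<delta> \<and>
    vector_derivative (\<phi> \<circ> \<delta>) (at 0) = vector_derivative (\<phi> \<circ> \<gamma>) (at 0)"
    using U c1_curve_at_0[OF \<gamma>] by (auto simp: velocity_def)
next
  assume \<delta>: "c1_curve_at M x \<delta> \<and>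
    vector_derivative (\<phi> \<circ> \<delta>) (at 0) = vector_derivative (\<phi> \<circ> \<gamma>) (at 0)"
  have "vector_derivative (\<psi> \<circ> \<delta>) (at 0) = vector_derivative (\<psi> \<circ> \<gamma>) (at 0)"
    if "(V, \<psi>) \<in> atlas M" "x \<in> V" for V \<psi>
    using \<delta> \<gamma> by (metis vector_derivative_chart_change[OF M U that])
  then show "\<delta> \<in> velocity M \<gamma>"
    using \<delta> c1_curve_at_0[OF \<gamma>] by (auto simp: velocity_def)
qed

lemma velocity_eq_iff:
  assumes M: "c1_charts M" and U: "(U, \<phi>) \<in> atlas M" "x \<in> U"
    and "c1_curve_at M x \<gamma>" "c1_curve_at M x \<delta>"
  shows "velocity M \<gamma> = velocity M \<delta> \<longleftrightarrow>
    vector_derivative (\<phi> \<circ> \<gamma>) (at 0) = vector_derivative (\<phi> \<circ> \<delta>) (at 0)"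
  using assms by (auto simp: set_eq_iff mem_velocity_iff[OF M U])

lemma mem_velocity_self: "c1_curve_at M x \<gamma> \<Longrightarrow> \<gamma> \<in> velocity M \<gamma>"
  using c1_curve_at_0[of M x \<gamma>] by (auto simp: velocity_def)

text \<open>
  The differential of a class is a union over its representatives; it can be computed from any of them
  once their images have a common velocity.
\<close>

lemma differential_velocity:
  assumes "c1_curve_at M x \<gamma>" "\<And>\<delta>. \<delta> \<in> velocity M \<gamma> \<Longrightarrow> velocity N (f \<circ> \<delta>) = V"
  shows "differential N f (velocity M \<gamma>) = V"
  unfolding differential_def
  by (rule SUP_eq_const) (use assms(2) mem_velocity_self[OF assms(1)] in auto)

section \<open>Submersions to the real line\<close>

lemma c1_charts_euclidean: "c1_charts (euclidean_manifold :: ('e::euclidean_space, 'e) manifold)"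
proof -
  have "homeomorphic_map euclidean euclidean (\<lambda>x::'e. x)"
    using homeomorphic_map_id[of euclidean euclidean] by (simp add: id_def)
  moreover have "c1_on (\<lambda>x::'e. x) UNIV"
    by (rule c1_on_bounded_linear) auto
  ultimately show ?thesis
    by (simp add: c1_charts_def euclidean_manifold_def chart_on_def c1_compatible_def o_def)
qed

lemma euclidean_atlas: "(UNIV, \<lambda>x. x) \<in> atlas euclidean_manifold"
  by (simp add: euclidean_manifold_def)

text \<open>
  A velocity with representative \<open>w\<close> in the chart is sent to \<open>D w\<close>, where \<open>D\<close> is the derivative of
  \<open>\<rho>\<close>. A multiple of \<open>u\<close> therefore reaches any given velocity on the line.
\<close>

lemma c1_submersion_on_chart:
  fixes M :: "('a, 'e::euclidean_space) manifold" and \<rho> :: "'e \<Rightarrow> real"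
  assumes M: "c1_charts M" and U: "(U, \<phi>) \<in> atlas M"
    and \<rho>: "c1_on \<rho> T" "T \<subseteq> \<phi> ` U" "\<And>q. q \<in> T \<Longrightarrow> frechet_derivative \<rho> (at q) u \<noteq> 0"
  shows "c1_submersion_on M euclidean_manifold {x \<in> U. \<phi> x \<in> T} (\<lambda>x. \<rho> (\<phi> x))"
proof -
  define W where "W = {x \<in> U. \<phi> x \<in> T}"
  define f where "f = (\<lambda>x. \<rho> (\<phi> x))"
  let ?R = "euclidean_manifold :: (real, real) manifold"
  note chart = c1_charts_chart_on[OF M U]
  have W: "openin (mtop M) W"
    unfolding W_def using chart c1_on_imp_open[OF \<rho>(1)] by (rule chart_on_openin_vimage)
  have "continuous_map (subtopology (mtop M) W) (top_of_set T) \<phi>"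
    using continuous_map_from_subtopology_mono[OF chart_on_continuous[OF chart], of W]
    by (auto simp: continuous_map_in_subtopology W_def)
  moreover have "continuous_map (top_of_set T) euclidean \<rho>"
    using c1_on_imp_continuous_on[OF \<rho>(1)] by simp
  ultimately have cont: "continuous_map (subtopology (mtop M) W) euclidean f"
    using continuous_map_compose[of _ _ \<phi> _ \<rho>] by (fastforce simp: f_def o_def)
  have charts: "c1_on (\<lambda>z. f (inv_into V \<psi> z)) (\<psi> ` (W \<inter> V))" if V: "(V, \<psi>) \<in> atlas M" for V \<psi>
  proof -
    note chart' = c1_charts_chart_on[OF M V]
    have "openin (mtop M) (W \<inter> V)"
      using W chart_on_openin[OF chart'] by (rule openin_Int)
    then have "open (\<psi> ` (W \<inter> V))" by (rule chart_on_open_map[OF chart']) simp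
    moreover have "\<psi> ` (W \<inter> V) \<subseteq> \<psi> ` (V \<inter> U)" by (auto simp: W_def)
    ultimately have "c1_on (\<lambda>z. \<phi> (inv_into V \<psi> z)) (\<psi> ` (W \<inter> V))"
      by (rule c1_on_subset[OF c1_charts_transition[OF M V U]])
    then show ?thesis
      unfolding f_def
      by (rule c1_on_compose[OF _ \<rho>(1)]) (auto simp: W_def inv_into_f_f[OF chart_on_inj[OF chart']])
  qed
  have map: "c1_map_on M ?R W f"
    using W cont charts by (auto simp: c1_map_on_def euclidean_manifold_def o_def Int_def)
  have "differential ?R f ` tangent_space M x = tangent_space ?R (f x)" if x: "x \<in> W" for x
  proof -
    have xU: "x \<in> U" and xT: "\<phi> x \<in> T" using x by (auto simp: W_def)
    define D where "D = frechet_derivative \<rho> (at (\<phi> x))"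
    have D: "(\<rho> has_derivative D) (at (\<phi> x))"
      unfolding D_def using \<rho>(1) xT by (rule c1_on_has_derivative)
    have push: "c1_curve_at ?R (f x) (f \<circ> \<gamma>)"
      "vector_derivative (f \<circ> \<gamma>) (at 0) = D (vector_derivative (\<phi> \<circ> \<gamma>) (at 0))"
      if \<gamma>: "c1_curve_at M x \<gamma>" for \<gamma>
    proof -
      obtain I where I: "\<gamma> 0 = x" "0 \<in> I" "c1_on (\<lambda>t. \<phi> (\<gamma> t)) I"
        using \<gamma> c1_curve_at_iff_chart[OF M U xU] by auto
      define J where "J = {t \<in> I. \<phi> (\<gamma> t) \<in> T}"
      have "open J" unfolding J_def using I(3) c1_on_imp_open[OF \<rho>(1)] by (rule c1_on_vimage_open)
      then have "c1_on (\<lambda>t. \<phi> (\<gamma> t)) J"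
        using I(3) by (auto intro: c1_on_subset simp: J_def)
      then have "c1_on (\<lambda>t. f (\<gamma> t)) J"
        unfolding f_def by (rule c1_on_compose[OF _ \<rho>(1)]) (auto simp: J_def)
      moreover have "0 \<in> J" using I xT by (simp add: J_def)
      ultimately show "c1_curve_at ?R (f x) (f \<circ> \<gamma>)"
        unfolding c1_curve_at_iff_chart[OF c1_charts_euclidean euclidean_atlas UNIV_I] o_def
        using I(1) by (intro conjI exI[of _ J]) auto
      have "((\<lambda>t. f (\<gamma> t)) has_derivative (\<lambda>h. D (h *\<^sub>R vector_derivative (\<phi> \<circ> \<gamma>) (at 0)))) (at 0)"
        unfolding f_def
        by (rule has_derivative_compose[OF c1_curve_at_has_vector_derivative[OF M U xU \<gamma>, unfolded has_vector_derivative_def]])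
          (use D I(1) in simp)
      then have "((f \<circ> \<gamma>) has_vector_derivative D (vector_derivative (\<phi> \<circ> \<gamma>) (at 0))) (at 0)"
        using linear_cmul[OF has_derivative_linear[OF D]] by (simp add: has_vector_derivative_def o_def)
      then show "vector_derivative (f \<circ> \<gamma>) (at 0) = D (vector_derivative (\<phi> \<circ> \<gamma>) (at 0))"
        by (rule vector_derivative_at)
    qed
    have R_velocity: "velocity ?R c = velocity ?R d \<longleftrightarrow> vector_derivative c (at 0) = vector_derivative d (at 0)"
      if "c1_curve_at ?R (f x) c" "c1_curve_at ?R (f x) d" for c d
      using velocity_eq_iff[OF c1_charts_euclidean euclidean_atlas UNIV_I that] by (simp add: o_def)
    have diff: "differential ?R f (velocity M \<gamma>) = velocity ?R (f \<circ> \<gamma>)" if \<gamma>: "c1_curve_at M x \<gamma>" for \<gamma>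
      by (rule differential_velocity[OF \<gamma>])
        (use \<gamma> push in \<open>auto simp: mem_velocity_iff[OF M U xU \<gamma>] R_velocity\<close>)
    show ?thesis
    proof (intro equalityI subsetI)
      fix v assume "v \<in> differential ?R f ` tangent_space M x"
      then obtain \<gamma> where "c1_curve_at M x \<gamma>" "v = differential ?R f (velocity M \<gamma>)"
        by (auto simp: tangent_space_def)
      then show "v \<in> tangent_space ?R (f x)"
        using diff push(1) by (auto simp: tangent_space_def)
    next
      fix v assume "v \<in> tangent_space ?R (f x)"
      then obtain c where c: "c1_curve_at ?R (f x) c" "v = velocity ?R c"
        by (auto simp: tangent_space_def)
      have "D u \<noteq> 0" using \<rho>(3)[OF xT] by (simp add: D_def)
      obtain \<gamma> where \<gamma>: "c1_curve_at M x \<gamma>"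
        "vector_derivative (\<phi> \<circ> \<gamma>) (at 0) = (vector_derivative c (at 0) / D u) *\<^sub>R u"
        using c1_curve_at_with_velocity[OF M U xU] by blast
      then have "vector_derivative (f \<circ> \<gamma>) (at 0) = vector_derivative c (at 0)"
        using push(2) linear_cmul[OF has_derivative_linear[OF D]] \<open>D u \<noteq> 0\<close> by simp
      then have "v = differential ?R f (velocity M \<gamma>)"
        using c \<gamma>(1) diff push(1) R_velocity by simp
      then show "v \<in> differential ?R f ` tangent_space M x"
        using \<gamma>(1) by (auto simp: tangent_space_def)
    qed
  qed
  with map show ?thesis
    unfolding c1_submersion_on_def W_def f_def by blast
qed

section \<open>Products\<close>

lemma chart_on_prod:
  assumes "chart_on X (U, \<phi>)" "chart_on Y (V, \<psi>)"
  shows "chart_on (prod_topology X Y) (U \<times> V, map_prod \<phi> \<psi>)"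
proof -
  have im: "map_prod \<phi> \<psi> ` (U \<times> V) = \<phi> ` U \<times> \<psi> ` V" by force
  from assms obtain \<phi>' \<psi>' where
    "homeomorphic_maps (subtopology X U) (top_of_set (\<phi> ` U)) \<phi> \<phi>'"
    "homeomorphic_maps (subtopology Y V) (top_of_set (\<psi> ` V)) \<psi> \<psi>'"
    by (auto simp: chart_on_def homeomorphic_map_maps)
  then have "homeomorphic_maps (subtopology (prod_topology X Y) (U \<times> V))
      (top_of_set (\<phi> ` U \<times> \<psi> ` V)) (map_prod \<phi> \<psi>) (map_prod \<phi>' \<psi>')"
    unfolding subtopology_Times map_prod_def
    using homeomorphic_maps_prod[of "subtopology X U" "subtopology Y V" "top_of_set (\<phi> ` U)"
        "top_of_set (\<psi> ` V)" \<phi> \<psi> \<phi>' \<psi>'] by simp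
  then show ?thesis
    using assms by (auto simp: chart_on_def im open_Times openin_prod_Times_iff homeomorphic_map_maps)
qed

lemma c1_on_transition_prod:
  assumes "inj_on \<phi> U" "inj_on \<psi> V"
    "c1_on (\<phi>' \<circ> inv_into U \<phi>) (\<phi> ` (U \<inter> U'))" "c1_on (\<psi>' \<circ> inv_into V \<psi>) (\<psi> ` (V \<inter> V'))"
  shows "c1_on (map_prod \<phi>' \<psi>' \<circ> inv_into (U \<times> V) (map_prod \<phi> \<psi>))
    (map_prod \<phi> \<psi> ` ((U \<times> V) \<inter> (U' \<times> V')))"
proof -
  have im: "map_prod \<phi> \<psi> ` ((U \<times> V) \<inter> (U' \<times> V')) = \<phi> ` (U \<inter> U') \<times> \<psi> ` (V \<inter> V')" by force
  have inj: "inj_on (map_prod \<phi> \<psi>) (U \<times> V)"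
    using assms(1,2) by (rule map_prod_inj_on)
  have inv: "inv_into (U \<times> V) (map_prod \<phi> \<psi>) (\<phi> x, \<psi> y) = (x, y)" if "x \<in> U" "y \<in> V" for x y
    using inv_into_f_f[OF inj, of "(x, y)"] that by simp
  show ?thesis
    unfolding im
    by (rule c1_on_cong[OF c1_on_map_prod[OF assms(3,4)]])
      (auto simp: inv inv_into_f_f assms(1,2))
qed

lemma c1_charts_prod:
  assumes M: "c1_charts M" and N: "c1_charts N"
  shows "c1_charts (prod_manifold M N)"
  unfolding c1_charts_def
proof (intro conjI ballI)
  show "chart_on (mtop (prod_manifold M N)) c" if "c \<in> atlas (prod_manifold M N)" for c
    using that M N by (auto simp: prod_manifold_def c1_charts_def intro!: chart_on_prod)
  have "(\<Union>c\<in>atlas (prod_manifold M N). fst c) =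
      (\<Union>c\<in>atlas M. fst c) \<times> (\<Union>c\<in>atlas N. fst c)"
    by (force simp: prod_manifold_def)
  then show "(\<Union>c\<in>atlas (prod_manifold M N). fst c) = topspace (mtop (prod_manifold M N))"
    using M N by (simp add: c1_charts_def prod_manifold_def)
  show "c1_compatible c d" if cd: "c \<in> atlas (prod_manifold M N)" "d \<in> atlas (prod_manifold M N)" for c d
  proof -
    obtain U \<phi> V \<psi> where c: "c = (U \<times> V, map_prod \<phi> \<psi>)" "(U, \<phi>) \<in> atlas M" "(V, \<psi>) \<in> atlas N"
      using cd(1) by (auto simp: prod_manifold_def)
    obtain U' \<phi>' V' \<psi>' where d: "d = (U' \<times> V', map_prod \<phi>' \<psi>')" "(U', \<phi>') \<in> atlas M" "(V', \<psi>') \<in> atlas N"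
      using cd(2) by (auto simp: prod_manifold_def)
    have "c1_compatible (U, \<phi>) (U', \<phi>')" "c1_compatible (V, \<psi>) (V', \<psi>')"
      using M N c d by (auto simp: c1_charts_def)
    then show ?thesis
      using c1_on_transition_prod[of \<phi> U \<psi> V \<phi>' U' \<psi>' V'] c1_on_transition_prod[of \<phi>' U' \<psi>' V' \<phi> U \<psi> V]
        chart_on_inj[OF c1_charts_chart_on[OF M]] chart_on_inj[OF c1_charts_chart_on[OF N]] c d
      by (simp add: c1_compatible_def Int_commute)
  qed
qed

lemma c1_curve_at_prod_iff:
  assumes M: "c1_charts M" and N: "c1_charts N"
    and x: "x \<in> topspace (mtop M)" and y: "y \<in> topspace (mtop N)"
  shows "c1_curve_at (prod_manifold M N) (x, y) \<gamma> \<longleftrightarrow>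
    c1_curve_at M x (fst \<circ> \<gamma>) \<and> c1_curve_at N y (snd \<circ> \<gamma>)"
proof -
  obtain U \<phi> where U: "(U, \<phi>) \<in> atlas M" "x \<in> U" using c1_charts_obtain[OF M x] .
  obtain V \<psi> where V: "(V, \<psi>) \<in> atlas N" "y \<in> V" using c1_charts_obtain[OF N y] .
  have UV: "(U \<times> V, map_prod \<phi> \<psi>) \<in> atlas (prod_manifold M N)" "(x, y) \<in> U \<times> V"
    using U V by (auto simp: prod_manifold_def)
  show ?thesis
    unfolding c1_curve_at_iff_chart[OF c1_charts_prod[OF M N] UV]
      c1_curve_at_iff_chart[OF M U] c1_curve_at_iff_chart[OF N V]
  proof safe
    fix I assume I: "\<gamma> 0 = (x, y)" "0 \<in> I" "\<forall>t\<in>I. \<gamma> t \<in> U \<times> V" "c1_on (\<lambda>t. map_prod \<phi> \<psi> (\<gamma> t)) I"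
    have "c1_on (\<lambda>t. fst (map_prod \<phi> \<psi> (\<gamma> t))) I" "c1_on (\<lambda>t. snd (map_prod \<phi> \<psi> (\<gamma> t))) I"
      using c1_on_compose[OF I(4) c1_on_bounded_linear[OF bounded_linear_fst open_UNIV]]
        c1_on_compose[OF I(4) c1_on_bounded_linear[OF bounded_linear_snd open_UNIV]] by auto
    then show "\<exists>I. 0 \<in> I \<and> (\<forall>t\<in>I. (fst \<circ> \<gamma>) t \<in> U) \<and> c1_on (\<lambda>t. \<phi> ((fst \<circ> \<gamma>) t)) I"
      "\<exists>I. 0 \<in> I \<and> (\<forall>t\<in>I. (snd \<circ> \<gamma>) t \<in> V) \<and> c1_on (\<lambda>t. \<psi> ((snd \<circ> \<gamma>) t)) I"
      using I(2,3) by (auto simp: mem_Times_iff intro!: exI[of _ I])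
  next
    fix I J
    assume I: "0 \<in> I" "\<forall>t\<in>I. (fst \<circ> \<gamma>) t \<in> U" "c1_on (\<lambda>t. \<phi> ((fst \<circ> \<gamma>) t)) I"
      and J: "0 \<in> J" "\<forall>t\<in>J. (snd \<circ> \<gamma>) t \<in> V" "c1_on (\<lambda>t. \<psi> ((snd \<circ> \<gamma>) t)) J"
    have "open (I \<inter> J)" using I J by (auto dest: c1_on_imp_open)
    then have "c1_on (\<lambda>t. (\<phi> ((fst \<circ> \<gamma>) t), \<psi> ((snd \<circ> \<gamma>) t))) (I \<inter> J)"
      using I J by (intro c1_on_Pair) (auto intro: c1_on_subset)
    then show "\<exists>I. 0 \<in> I \<and> (\<forall>t\<in>I. \<gamma> t \<in> U \<times> V) \<and> c1_on (\<lambda>t. map_prod \<phi> \<psi> (\<gamma> t)) I"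
      using I J by (intro exI[of _ "I \<inter> J"]) (auto simp: mem_Times_iff map_prod_def split_def)
  qed (auto simp: prod_eq_iff)
qed

lemma vector_derivative_prod_chart:
  assumes M: "c1_charts M" and N: "c1_charts N"
    and U: "(U, \<phi>) \<in> atlas M" "x \<in> U" and V: "(V, \<psi>) \<in> atlas N" "y \<in> V"
    and \<gamma>: "c1_curve_at (prod_manifold M N) (x, y) \<gamma>"
  shows "((\<lambda>t. (\<phi> (fst (\<gamma> t)), \<psi> (snd (\<gamma> t)))) has_vector_derivative
    (vector_derivative (\<phi> \<circ> (fst \<circ> \<gamma>)) (at 0), vector_derivative (\<psi> \<circ> (snd \<circ> \<gamma>)) (at 0))) (at 0)"
proof -
  have top: "x \<in> topspace (mtop M)" "y \<in> topspace (mtop N)"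
    by (rule chart_domain_in_topspace[OF M U] chart_domain_in_topspace[OF N V])+
  then have "c1_curve_at M x (fst \<circ> \<gamma>)" "c1_curve_at N y (snd \<circ> \<gamma>)"
    using \<gamma> c1_curve_at_prod_iff[OF M N] by auto
  then show ?thesis
    using c1_curve_at_has_vector_derivative[OF M U] c1_curve_at_has_vector_derivative[OF N V]
    by (intro has_vector_derivative_Pair) fastforce+
qed

text \<open>
  A curve in the product has a velocity whose components in a product chart are those of its two
  projections, so projecting curves is compatible with passing to velocities.
\<close>

lemma differential_projections:
  assumes M: "c1_charts M" and N: "c1_charts N"
    and x: "x \<in> topspace (mtop M)" and y: "y \<in> topspace (mtop N)"
    and \<gamma>: "c1_curve_at (prod_manifold M N) (x, y) \<gamma>"
  shows "differential M fst (velocity (prod_manifold M N) \<gamma>) = velocity M (fst \<circ> \<gamma>)"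
    and "differential N snd (velocity (prod_manifold M N) \<gamma>) = velocity N (snd \<circ> \<gamma>)"
proof -
  obtain U \<phi> where U: "(U, \<phi>) \<in> atlas M" "x \<in> U" using c1_charts_obtain[OF M x] .
  obtain V \<psi> where V: "(V, \<psi>) \<in> atlas N" "y \<in> V" using c1_charts_obtain[OF N y] .
  have UV: "(U \<times> V, map_prod \<phi> \<psi>) \<in> atlas (prod_manifold M N)" "(x, y) \<in> U \<times> V"
    using U V by (auto simp: prod_manifold_def)
  have vd: "vector_derivative (map_prod \<phi> \<psi> \<circ> \<delta>) (at 0) =
      (vector_derivative (\<phi> \<circ> (fst \<circ> \<delta>)) (at 0), vector_derivative (\<psi> \<circ> (snd \<circ> \<delta>)) (at 0))"
    if "c1_curve_at (prod_manifold M N) (x, y) \<delta>" for \<delta>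
    using vector_derivative_at[OF vector_derivative_prod_chart[OF M N U V that]]
    by (simp add: o_def map_prod_def split_def)
  note split = c1_curve_at_prod_iff[OF M N x y]
  have "velocity M (fst \<circ> \<delta>) = velocity M (fst \<circ> \<gamma>) \<and> velocity N (snd \<circ> \<delta>) = velocity N (snd \<circ> \<gamma>)"
    if "\<delta> \<in> velocity (prod_manifold M N) \<gamma>" for \<delta>
  proof -
    from that have \<delta>: "c1_curve_at (prod_manifold M N) (x, y) \<delta>"
      and "vector_derivative (map_prod \<phi> \<psi> \<circ> \<delta>) (at 0) = vector_derivative (map_prod \<phi> \<psi> \<circ> \<gamma>) (at 0)"
      using mem_velocity_iff[OF c1_charts_prod[OF M N] UV \<gamma>] by auto
    then show ?thesis
      using \<delta> \<gamma> split vd velocity_eq_iff[OF M U] velocity_eq_iff[OF N V] by auto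
  qed
  then show "differential M fst (velocity (prod_manifold M N) \<gamma>) = velocity M (fst \<circ> \<gamma>)"
    "differential N snd (velocity (prod_manifold M N) \<gamma>) = velocity N (snd \<circ> \<gamma>)"
    using differential_velocity[OF \<gamma>] by blast+
qed

section \<open>Equations of a hypersurface in charts\<close>

text \<open>
  On the part of a product chart with coordinates in \<open>\<Omega>\<close>, the set \<open>P\<close> is the zero set of \<open>F\<close>.
  The notion is symmetric in the two factors (lemma \<open>swap\<close> below), so that \<open>lift_curve\<close> and
  \<open>constant_tangents_imp_separated\<close> need only be proved for one of them.
\<close>

locale chart_equation =
  fixes M :: "('a, 'e::euclidean_space) manifold" and N :: "('b, 'f::euclidean_space) manifold"
    and P :: "('a \<times> 'b) set" and U \<phi> V \<psi> and \<Omega> :: "('e \<times> 'f) set" and F :: "'e \<times> 'f \<Rightarrow> real"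
  assumes M: "c1_charts M" and N: "c1_charts N"
    and U: "(U, \<phi>) \<in> atlas M" and V: "(V, \<psi>) \<in> atlas N"
    and F: "c1_on F \<Omega>" and \<Omega>: "\<Omega> \<subseteq> \<phi> ` U \<times> \<psi> ` V"
    and eq: "x \<in> U \<Longrightarrow> y \<in> V \<Longrightarrow> (\<phi> x, \<psi> y) \<in> \<Omega> \<Longrightarrow> (x, y) \<in> P \<longleftrightarrow> F (\<phi> x, \<psi> y) = 0"
begin

lemma swap: "chart_equation N M (P\<inverse>) V \<psi> U \<phi> (prod.swap -` \<Omega>) (\<lambda>z. F (prod.swap z))"
proof
  have "open (prod.swap -` \<Omega>)"
    by (rule open_vimage[OF c1_on_imp_open[OF F] linear_continuous_on[OF bounded_linear_swap]])
  then show "c1_on (\<lambda>z. F (prod.swap z)) (prod.swap -` \<Omega>)"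
    by (rule c1_on_compose[OF c1_on_bounded_linear[OF bounded_linear_swap] F]) auto
qed (use M N U V \<Omega> eq in auto)

lemma inj: "inj_on \<phi> U" "inj_on \<psi> V"
  using chart_on_inj c1_charts_chart_on M N U V by blast+

lemma topspaces: "x \<in> U \<Longrightarrow> x \<in> topspace (mtop M)" "y \<in> V \<Longrightarrow> y \<in> topspace (mtop N)"
  by (auto intro: chart_domain_in_topspace[OF M U] chart_domain_in_topspace[OF N V])

lemma derivative_vanishes_on_tangent:
  assumes xy: "x \<in> U" "y \<in> V" "(\<phi> x, \<psi> y) \<in> \<Omega>"
    and D: "(F has_derivative D) (at (\<phi> x, \<psi> y))"
    and \<gamma>: "c1_curve_at (prod_manifold M N) (x, y) \<gamma>" "\<forall>\<^sub>F t in nhds 0. \<gamma> t \<in> P"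
  shows "D (vector_derivative (\<phi> \<circ> (fst \<circ> \<gamma>)) (at 0), vector_derivative (\<psi> \<circ> (snd \<circ> \<gamma>)) (at 0)) = 0"
    (is "D ?w = 0")
proof -
  let ?c = "\<lambda>t. (\<phi> (fst (\<gamma> t)), \<psi> (snd (\<gamma> t)))"
  have c: "(?c has_vector_derivative ?w) (at 0)"
    using vector_derivative_prod_chart[OF M N U xy(1) V xy(2) \<gamma>(1)] .
  have c0: "?c 0 = (\<phi> x, \<psi> y)" using c1_curve_at_0[OF \<gamma>(1)] by simp
  have Fc: "((\<lambda>t. F (?c t)) has_derivative (\<lambda>h. D (h *\<^sub>R ?w))) (at 0)"
    by (rule has_derivative_compose[OF c[unfolded has_vector_derivative_def]]) (use D c0 in simp)
  have "(?c \<longlongrightarrow> (\<phi> x, \<psi> y)) (at 0)"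
    using has_vector_derivative_continuous[OF c] c0 by (simp add: isCont_def)
  then have ev1: "\<forall>\<^sub>F t in nhds 0. ?c t \<in> \<Omega>"
    using topological_tendstoD[OF _ c1_on_imp_open[OF F] xy(3)] xy(3) c0
    by (simp add: eventually_nhds_conv_at)
  have "openin (mtop (prod_manifold M N)) (U \<times> V)"
    using chart_on_openin[OF c1_charts_chart_on[OF M U]] chart_on_openin[OF c1_charts_chart_on[OF N V]]
    by (simp add: prod_manifold_def openin_prod_Times_iff)
  then have ev2: "\<forall>\<^sub>F t in nhds 0. \<gamma> t \<in> U \<times> V"
    by (rule c1_curve_at_eventually_in[OF \<gamma>(1)]) (use xy in auto)
  have "\<forall>\<^sub>F t in nhds 0. 0 = F (?c t)"
    using ev1 ev2 \<gamma>(2)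
  proof eventually_elim
    case (elim t)
    then show ?case using eq[of "fst (\<gamma> t)" "snd (\<gamma> t)"] by (auto simp: mem_Times_iff)
  qed
  then have "((\<lambda>t. F (?c t)) has_derivative (\<lambda>h. 0)) (at 0)"
    by (intro has_derivative_transform_eventually[OF has_derivative_const])
      (auto simp: eventually_nhds_conv_at)
  from has_derivative_unique[OF Fc this] have "D (1 *\<^sub>R ?w) = 0" by metis
  then show ?thesis by simp
qed

text \<open>
  The equation \<open>F (\<phi> (\<gamma> t), \<psi> y + s *\<^sub>R v) = 0\<close> is solved for \<open>s\<close> as a function of \<open>t\<close>. This
  makes every velocity of the first factor the projection of one tangent to \<open>P\<close>.
\<close>

lemma lift_curve:
  assumes xy: "x \<in> U" "y \<in> V" "(\<phi> x, \<psi> y) \<in> \<Omega>" "(x, y) \<in> P"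
    and D: "(F has_derivative D) (at (\<phi> x, \<psi> y))" "D (0, v) \<noteq> 0"
    and \<gamma>: "c1_curve_at M x \<gamma>"
  obtains \<delta> where "c1_curve_at N y \<delta>" "\<forall>\<^sub>F t in nhds 0. (\<gamma> t, \<delta> t) \<in> P"
proof -
  have F0: "F (\<phi> x, \<psi> y) = 0" using eq xy by simp
  obtain A e H where H: "(\<phi> x, \<psi> y) \<in> A" "e > 0" "c1_on H A" "H (\<phi> x, \<psi> y) = 0"
    "\<And>z. z \<in> A \<Longrightarrow> \<bar>H z\<bar> < e"
    "\<And>z s. z \<in> A \<Longrightarrow> \<bar>s\<bar> < e \<Longrightarrow> z + s *\<^sub>R (0, v) \<in> \<Omega>"
    "\<And>z s. z \<in> A \<Longrightarrow> \<bar>s\<bar> < e \<Longrightarrow> F (z + s *\<^sub>R (0, v)) = 0 \<longleftrightarrow> s = H z"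
    by (rule implicit_along[OF F xy(3) F0 D]) blast
  obtain I where I: "\<gamma> 0 = x" "0 \<in> I" "\<And>t. t \<in> I \<Longrightarrow> \<gamma> t \<in> U" "c1_on (\<lambda>t. \<phi> (\<gamma> t)) I"
    using \<gamma> c1_curve_at_iff_chart[OF M U xy(1)] by auto
  have base: "c1_on (\<lambda>t. (\<phi> (\<gamma> t), \<psi> y)) I"
    using I(4) by (intro c1_on_Pair c1_on_const) (auto dest: c1_on_imp_open)
  define J where "J = {t \<in> I. (\<phi> (\<gamma> t), \<psi> y) \<in> A}"
  have "open J"
    unfolding J_def using base c1_on_imp_open[OF H(3)] by (rule c1_on_vimage_open)
  have "0 \<in> J" using I H(1) by (simp add: J_def)
  have "c1_on (\<lambda>t. (\<phi> (\<gamma> t), \<psi> y)) J"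
    using base \<open>open J\<close> by (rule c1_on_subset) (auto simp: J_def)
  then have HJ: "c1_on (\<lambda>t. H (\<phi> (\<gamma> t), \<psi> y)) J"
    by (rule c1_on_compose[OF _ H(3)]) (auto simp: J_def)
  define c where "c = (\<lambda>t. \<psi> y + H (\<phi> (\<gamma> t), \<psi> y) *\<^sub>R v)"
  have c: "c1_on c J"
    unfolding c_def using HJ \<open>open J\<close> by (intro c1_on_add c1_on_const c1_on_scaleR_left)
  have on: "(\<phi> (\<gamma> t), c t) \<in> \<Omega>" "F (\<phi> (\<gamma> t), c t) = 0" if "t \<in> J" for t
  proof -
    have *: "(\<phi> (\<gamma> t), \<psi> y) \<in> A" using that by (simp add: J_def)
    show "(\<phi> (\<gamma> t), c t) \<in> \<Omega>" "F (\<phi> (\<gamma> t), c t) = 0"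
      using H(6)[OF * H(5)[OF *]] H(7)[OF * H(5)[OF *]] by (simp_all add: c_def)
  qed
  have cV: "c t \<in> \<psi> ` V" if "t \<in> J" for t using on(1)[OF that] \<Omega> by auto
  then have "c ` J \<subseteq> \<psi> ` V" by blast
  from c1_curve_at_lift[OF N V c \<open>0 \<in> J\<close> this]
  have curve: "c1_curve_at N y (\<lambda>t. inv_into V \<psi> (c t))"
    using I(1) H(4) xy(2) by (simp add: c_def inv_into_f_f[OF inj(2)])
  have "(\<gamma> t, inv_into V \<psi> (c t)) \<in> P" if "t \<in> J" for t
    using eq[of "\<gamma> t" "inv_into V \<psi> (c t)"] on[OF that] cV[OF that] I(3) that
    by (auto simp: J_def f_inv_into_f inv_into_into)
  then have "\<forall>\<^sub>F t in nhds 0. (\<gamma> t, inv_into V \<psi> (c t)) \<in> P"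
    using eventually_nhds_in_open[OF \<open>open J\<close> \<open>0 \<in> J\<close>] by (auto elim: eventually_mono)
  with curve show thesis by (rule that)
qed

text \<open>
  By surjectivity onto the first factor, every \<open>a\<close> has some \<open>b\<close> with \<open>D (a, b) = 0\<close>. If \<open>D\<close> vanished on
  all \<open>(0, b)\<close>, it would then vanish on all \<open>(a, 0)\<close> as well, and so be zero. The other
  factor is treated in the same way.
\<close>

lemma transverse_imp_nonzero:
  assumes xy: "x \<in> U" "y \<in> V" "(\<phi> x, \<psi> y) \<in> \<Omega>"
    and D: "(F has_derivative D) (at (\<phi> x, \<psi> y))" "D w \<noteq> 0"
    and transverse: "transverse_at M N P (x, y)"
  obtains u v where "D (u, 0) \<noteq> 0" "D (0, v) \<noteq> 0"
proof -
  have lin: "linear D" using D(1) by (rule has_derivative_linear)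
  have split: "D (a, b) = D (a, 0) + D (0, b)" for a b
    using linear_add[OF lin, of "(a, 0)" "(0, b)"] by simp
  note proj = differential_projections[OF M N topspaces(1)[OF xy(1)] topspaces(2)[OF xy(2)]]
  note curves = c1_curve_at_prod_iff[OF M N topspaces(1)[OF xy(1)] topspaces(2)[OF xy(2)]]
  have "\<exists>b. D (a, b) = 0" for a
  proof -
    obtain c where c: "c1_curve_at M x c" "vector_derivative (\<phi> \<circ> c) (at 0) = a"
      using c1_curve_at_with_velocity[OF M U xy(1)] .
    then have "velocity M c \<in> differential M fst ` sub_tangent_space (prod_manifold M N) P (x, y)"
      using transverse by (auto simp: transverse_at_def tangent_space_def)
    then obtain \<gamma> where \<gamma>: "c1_curve_at (prod_manifold M N) (x, y) \<gamma>" "\<forall>\<^sub>F t in nhds 0. \<gamma> t \<in> P"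
      "velocity M c = differential M fst (velocity (prod_manifold M N) \<gamma>)"
      by (auto simp: sub_tangent_space_def)
    then have "vector_derivative (\<phi> \<circ> (fst \<circ> \<gamma>)) (at 0) = a"
      using proj(1) curves c velocity_eq_iff[OF M U xy(1) c(1), of "fst \<circ> \<gamma>"] by auto
    then show ?thesis using derivative_vanishes_on_tangent[OF xy D(1) \<gamma>(1,2)] by blast
  qed
  moreover have "\<exists>a. D (a, b) = 0" for b
  proof -
    obtain c where c: "c1_curve_at N y c" "vector_derivative (\<psi> \<circ> c) (at 0) = b"
      using c1_curve_at_with_velocity[OF N V xy(2)] .
    then have "velocity N c \<in> differential N snd ` sub_tangent_space (prod_manifold M N) P (x, y)"
      using transverse by (auto simp: transverse_at_def tangent_space_def)
    then obtain \<gamma> where \<gamma>: "c1_curve_at (prod_manifold M N) (x, y) \<gamma>" "\<forall>\<^sub>F t in nhds 0. \<gamma> t \<in> P"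
      "velocity N c = differential N snd (velocity (prod_manifold M N) \<gamma>)"
      by (auto simp: sub_tangent_space_def)
    then have "vector_derivative (\<psi> \<circ> (snd \<circ> \<gamma>)) (at 0) = b"
      using proj(2) curves c velocity_eq_iff[OF N V xy(2) c(1), of "snd \<circ> \<gamma>"] by auto
    then show ?thesis using derivative_vanishes_on_tangent[OF xy D(1) \<gamma>(1,2)] by blast
  qed
  ultimately have "\<exists>u. D (u, 0) \<noteq> 0" "\<exists>v. D (0, v) \<noteq> 0"
    using D(2) split by (metis add_0 add.right_neutral prod.collapse)+
  then show thesis using that by blast
qed

lemma nonzero_imp_transverse:
  assumes xy: "x \<in> U" "y \<in> V" "(\<phi> x, \<psi> y) \<in> \<Omega>" "(x, y) \<in> P"
    and D: "(F has_derivative D) (at (\<phi> x, \<psi> y))" "D (u, 0) \<noteq> 0" "D (0, v) \<noteq> 0"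
  shows "transverse_at M N P (x, y)"
proof -
  interpret swapped: chart_equation N M "P\<inverse>" V \<psi> U \<phi> "prod.swap -` \<Omega>" "\<lambda>z. F (prod.swap z)"
    by (rule swap)
  note proj = differential_projections[OF M N topspaces(1)[OF xy(1)] topspaces(2)[OF xy(2)]]
  note curves = c1_curve_at_prod_iff[OF M N topspaces(1)[OF xy(1)] topspaces(2)[OF xy(2)]]
  note D' = has_derivative_swap[OF D(1)]
  have "velocity M c \<in> differential M fst ` sub_tangent_space (prod_manifold M N) P (x, y)"
    if c: "c1_curve_at M x c" for c
  proof -
    obtain \<delta> where \<delta>: "c1_curve_at N y \<delta>" "\<forall>\<^sub>F t in nhds 0. (c t, \<delta> t) \<in> P"
      using lift_curve[OF xy D(1,3) c] .
    then have "c1_curve_at (prod_manifold M N) (x, y) (\<lambda>t. (c t, \<delta> t))"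
      using curves c by (simp add: o_def)
    from proj(1)[OF this] this \<delta>(2) show ?thesis
      by (force simp: sub_tangent_space_def o_def)
  qed
  moreover have "velocity N c \<in> differential N snd ` sub_tangent_space (prod_manifold M N) P (x, y)"
    if c: "c1_curve_at N y c" for c
  proof -
    obtain \<delta> where \<delta>: "c1_curve_at M x \<delta>" "\<forall>\<^sub>F t in nhds 0. (c t, \<delta> t) \<in> P\<inverse>"
      by (rule swapped.lift_curve[OF xy(2,1) _ _ D' _ c, of u]) (use xy D in auto)
    then have "c1_curve_at (prod_manifold M N) (x, y) (\<lambda>t. (\<delta> t, c t))"
      using curves c by (simp add: o_def)
    from proj(2)[OF this] this \<delta>(2) show ?thesis
      by (force simp: sub_tangent_space_def o_def)
  qed
  moreover have "differential M fst ` sub_tangent_space (prod_manifold M N) P (x, y) \<subseteq> tangent_space M x"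
    "differential N snd ` sub_tangent_space (prod_manifold M N) P (x, y) \<subseteq> tangent_space N y"
    using proj curves by (force simp: sub_tangent_space_def tangent_space_def)+
  ultimately show ?thesis
    by (auto simp: transverse_at_def tangent_space_def)
qed

lemma openin_chart_vimage:
  "open A \<Longrightarrow> openin (mtop M) {x \<in> U. \<phi> x \<in> A}" "open B \<Longrightarrow> openin (mtop N) {y \<in> V. \<psi> y \<in> B}"
  using chart_on_openin_vimage c1_charts_chart_on M N U V by blast+

lemma obtain_transverse_nhds:
  assumes xy: "x \<in> U" "y \<in> V" "(\<phi> x, \<psi> y) \<in> \<Omega>"
    and D: "(F has_derivative D) (at (\<phi> x, \<psi> y))" "D (u, 0) \<noteq> 0" "D (0, v) \<noteq> 0"
  obtains A B where "transverse_nhds M N P (x, y) A B"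
proof -
  obtain S where S: "(\<phi> x, \<psi> y) \<in> S" "S \<subseteq> \<Omega>" "c1_on F S"
    "\<And>z. z \<in> S \<Longrightarrow> frechet_derivative F (at z) (u, 0) \<noteq> 0"
    by (rule c1_on_nonzero_derivative_nearby[OF F xy(3) D(1,2)]) blast
  obtain T where T: "(\<phi> x, \<psi> y) \<in> T" "T \<subseteq> \<Omega>" "c1_on F T"
    "\<And>z. z \<in> T \<Longrightarrow> frechet_derivative F (at z) (0, v) \<noteq> 0"
    by (rule c1_on_nonzero_derivative_nearby[OF F xy(3) D(1,3)]) blast
  have "open (S \<inter> T)" using S(3) T(3) by (auto dest: c1_on_imp_open)
  moreover have "(\<phi> x, \<psi> y) \<in> S \<inter> T" using S T by simp
  ultimately obtain A B where AB: "open A" "open B" "\<phi> x \<in> A" "\<psi> y \<in> B" "A \<times> B \<subseteq> S \<inter> T"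
    by (rule open_prod_elim) auto
  have "transverse_at M N P w" if w_in: "w \<in> P \<inter> ({x \<in> U. \<phi> x \<in> A} \<times> {y \<in> V. \<psi> y \<in> B})" for w
  proof -
    obtain a b where w: "w = (a, b)" "(a, b) \<in> P" "a \<in> U" "b \<in> V" "(\<phi> a, \<psi> b) \<in> A \<times> B"
      using w_in by auto
    then have "(\<phi> a, \<psi> b) \<in> S" "(\<phi> a, \<psi> b) \<in> T" "(\<phi> a, \<psi> b) \<in> \<Omega>" using AB(5) S(2) by blast+
    then show ?thesis
      unfolding w(1)
      using nonzero_imp_transverse[OF w(3,4) _ w(2) c1_on_has_derivative[OF F]] S(4) T(4) by blast
  qed
  then show thesis
    using xy AB openin_chart_vimage
    by (intro that[of "{x \<in> U. \<phi> x \<in> A}" "{y \<in> V. \<psi> y \<in> B}"]) (auto simp: transverse_nhds_def)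
qed

text \<open>
  This transports \<open>separate_variables\<close> to the manifolds: curves in slices are lifted to the second
  manifold, replaced there by curves in another slice with the same velocity, and read in
  the chart again.
\<close>

lemma constant_tangents_imp_separated:
  assumes xy: "x\<^sub>0 \<in> U" "y\<^sub>0 \<in> V" "(\<phi> x\<^sub>0, \<psi> y\<^sub>0) \<in> \<Omega>" "(x\<^sub>0, y\<^sub>0) \<in> P"
    and D: "(F has_derivative D) (at (\<phi> x\<^sub>0, \<psi> y\<^sub>0))" "D (u, 0) \<noteq> 0" "D (0, v) \<noteq> 0"
    and X: "openin (mtop M) X" "x\<^sub>0 \<in> X" and Y: "openin (mtop N) Y" "y\<^sub>0 \<in> Y"
    and tangent: "\<And>x x' y. x \<in> X \<Longrightarrow> x' \<in> X \<Longrightarrow> y \<in> Y \<Longrightarrow> (x, y) \<in> P \<Longrightarrow> (x', y) \<in> P \<Longrightarrow>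
      sub_tangent_space N (xslice P x) y = sub_tangent_space N (xslice P x') y"
  shows "\<exists>A B (f :: 'a \<Rightarrow> real) (g :: 'b \<Rightarrow> real).
    openin (mtop M) A \<and> x\<^sub>0 \<in> A \<and> openin (mtop N) B \<and> y\<^sub>0 \<in> B \<and>
    c1_submersion_on M euclidean_manifold A f \<and> c1_submersion_on N euclidean_manifold B g \<and>
    P \<inter> (A \<times> B) = {(x, y). x \<in> A \<and> y \<in> B \<and> f x = g y}"
proof -
  have oXY: "openin (mtop M) (U \<inter> X)" "openin (mtop N) (V \<inter> Y)"
    using X Y chart_on_openin c1_charts_chart_on M N U V by blast+
  have oi: "open (\<phi> ` (U \<inter> X))" "open (\<psi> ` (V \<inter> Y))"
    using chart_on_open_map[OF c1_charts_chart_on[OF M U] oXY(1)]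
      chart_on_open_map[OF c1_charts_chart_on[OF N V] oXY(2)] by auto
  define \<Omega>' where "\<Omega>' = \<Omega> \<inter> (\<phi> ` (U \<inter> X) \<times> \<psi> ` (V \<inter> Y))"
  have F': "c1_on F \<Omega>'"
    using F by (rule c1_on_subset) (use oi F in \<open>auto simp: \<Omega>'_def open_Times dest: c1_on_imp_open\<close>)
  have z0: "(\<phi> x\<^sub>0, \<psi> y\<^sub>0) \<in> \<Omega>'" "F (\<phi> x\<^sub>0, \<psi> y\<^sub>0) = 0"
    using xy X Y eq by (auto simp: \<Omega>'_def)
  obtain A B and f :: "'e \<Rightarrow> real" and g :: "'f \<Rightarrow> real" where
    AB: "\<phi> x\<^sub>0 \<in> A" "\<psi> y\<^sub>0 \<in> B" "A \<times> B \<subseteq> \<Omega>'" "c1_on f A" "c1_on g B"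
    "\<And>p. p \<in> A \<Longrightarrow> frechet_derivative f (at p) u \<noteq> 0"
    "\<And>q. q \<in> B \<Longrightarrow> frechet_derivative g (at q) v \<noteq> 0"
    "\<And>p q. p \<in> A \<Longrightarrow> q \<in> B \<Longrightarrow> F (p, q) = 0 \<longleftrightarrow> f p = g q"
  proof (rule separate_variables[OF F' z0 D])
    fix p p' q and c :: "real \<Rightarrow> 'f" and I
    assume pq: "(p, q) \<in> \<Omega>'" "(p', q) \<in> \<Omega>'" "F (p, q) = 0" "F (p', q) = 0"
      and c: "c 0 = q" "0 \<in> I" "c1_on c I" "\<And>t. t \<in> I \<Longrightarrow> (p, c t) \<in> \<Omega>' \<and> F (p, c t) = 0"
    from pq obtain x x' y where x: "x \<in> U" "x \<in> X" "\<phi> x = p" and x': "x' \<in> U" "x' \<in> X" "\<phi> x' = p'"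
      and y: "y \<in> V" "y \<in> Y" "\<psi> y = q"
      unfolding \<Omega>'_def by blast
    have P: "(x, y) \<in> P" "(x', y) \<in> P" using eq x x' y pq by (auto simp: \<Omega>'_def)
    have cV: "c t \<in> \<psi> ` V" if "t \<in> I" for t using c(4)[OF that] by (auto simp: \<Omega>'_def)
    define \<gamma> where "\<gamma> = (\<lambda>t. inv_into V \<psi> (c t))"
    have \<gamma>: "\<gamma> t \<in> V" "\<psi> (\<gamma> t) = c t" if "t \<in> I" for t
      using cV[OF that] by (auto simp: \<gamma>_def inv_into_into f_inv_into_f)
    have \<gamma>_curve: "c1_curve_at N y \<gamma>"
    proof -
      have "c ` I \<subseteq> \<psi> ` V" using cV by blast
      from c1_curve_at_lift[OF N V c(3,2) this] show ?thesis
        using inv_into_f_f[OF inj(2) y(1)] c(1) y(3) by (simp add: \<gamma>_def)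
    qed
    have "\<gamma> t \<in> xslice P x" if "t \<in> I" for t
      using eq[OF x(1) \<gamma>(1)[OF that]] \<gamma>(2)[OF that] c(4)[OF that] x(3) by (auto simp: \<Omega>'_def xslice_def)
    then have "\<forall>\<^sub>F t in nhds 0. \<gamma> t \<in> xslice P x"
      using eventually_nhds_in_open[OF c1_on_imp_open[OF c(3)] c(2)] by (auto elim: eventually_mono)
    then have "velocity N \<gamma> \<in> sub_tangent_space N (xslice P x') y"
      using tangent[OF x(2) x'(2) y(2) P] \<gamma>_curve by (auto simp: sub_tangent_space_def)
    then obtain \<gamma>' where \<gamma>': "c1_curve_at N y \<gamma>'" "\<forall>\<^sub>F t in nhds 0. \<gamma>' t \<in> xslice P x'"
      "velocity N \<gamma> = velocity N \<gamma>'"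
      by (auto simp: sub_tangent_space_def)
    have "((\<lambda>t. \<psi> (\<gamma> t)) has_vector_derivative vector_derivative (\<psi> \<circ> \<gamma>) (at 0)) (at 0)"
      using c1_curve_at_has_vector_derivative[OF N V y(1) \<gamma>_curve] .
    then have "(c has_vector_derivative vector_derivative (\<psi> \<circ> \<gamma>) (at 0)) (at 0)"
      by (rule has_vector_derivative_transform_within_open[OF _ c1_on_imp_open[OF c(3)] c(2)])
        (simp add: \<gamma>(2))
    then have "vector_derivative c (at 0) = vector_derivative (\<psi> \<circ> \<gamma>) (at 0)"
      by (rule vector_derivative_at)
    also have "\<dots> = vector_derivative (\<psi> \<circ> \<gamma>') (at 0)"
      using \<gamma>'(3) velocity_eq_iff[OF N V y(1) \<gamma>_curve \<gamma>'(1)] by simp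
    finally have "((\<lambda>t. \<psi> (\<gamma>' t)) has_vector_derivative vector_derivative c (at 0)) (at 0)"
      using c1_curve_at_has_vector_derivative[OF N V y(1) \<gamma>'(1)] by simp
    moreover have "\<forall>\<^sub>F t in nhds 0. (p', \<psi> (\<gamma>' t)) \<in> \<Omega>' \<longrightarrow> F (p', \<psi> (\<gamma>' t)) = 0"
      using \<gamma>'(2) c1_curve_at_eventually_in[OF \<gamma>'(1) chart_on_openin[OF c1_charts_chart_on[OF N V]] y(1)]
      by eventually_elim (use eq x' in \<open>auto simp: xslice_def \<Omega>'_def\<close>)
    ultimately show "\<exists>c'. (c' has_vector_derivative vector_derivative c (at 0)) (at 0) \<and> c' 0 = q \<and>
        (\<forall>\<^sub>F t in nhds 0. (p', c' t) \<in> \<Omega>' \<longrightarrow> F (p', c' t) = 0)"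
      using c1_curve_at_0[OF \<gamma>'(1)] y(3) by (intro exI[of _ "\<lambda>t. \<psi> (\<gamma>' t)"]) simp
  qed blast
  have sub: "A \<subseteq> \<phi> ` U" "B \<subseteq> \<psi> ` V" using AB(1,2,3) by (auto simp: \<Omega>'_def)
  let ?A = "{x \<in> U. \<phi> x \<in> A}" and ?B = "{y \<in> V. \<psi> y \<in> B}"
  have "P \<inter> (?A \<times> ?B) = {(x, y). x \<in> ?A \<and> y \<in> ?B \<and> f (\<phi> x) = g (\<psi> y)}"
  proof -
    have "(x, y) \<in> P \<longleftrightarrow> f (\<phi> x) = g (\<psi> y)" if "x \<in> ?A" "y \<in> ?B" for x y
      using eq[of x y] AB(8)[of "\<phi> x" "\<psi> y"] subsetD[OF AB(3), of "(\<phi> x, \<psi> y)"] that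
      by (simp add: \<Omega>'_def)
    then show ?thesis by blast
  qed
  then show ?thesis
    using xy AB(1,2) openin_chart_vimage AB(4,5)[THEN c1_on_imp_open]
      c1_submersion_on_chart[OF M U AB(4) sub(1) AB(6)] c1_submersion_on_chart[OF N V AB(5) sub(2) AB(7)]
    by (intro exI[of _ ?A] exI[of _ ?B] exI[of _ "\<lambda>x. f (\<phi> x)"] exI[of _ "\<lambda>y. g (\<psi> y)"]) auto
qed

end

lemma hyperplane_of_codim_1:
  fixes H :: "'e::euclidean_space set"
  assumes "subspace H" "dim H + 1 = DIM('e)"
  obtains a where "a \<noteq> 0" "H = {z. a \<bullet> z = 0}"
proof -
  obtain a where a: "a \<noteq> 0" "span H \<subseteq> {z. a \<bullet> z = 0}"
    using lowdim_subset_hyperplane[of H] assms(2) by auto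
  then have "H \<subseteq> {z. a \<bullet> z = 0}" using span_superset[of H] by blast
  moreover have "dim {z. a \<bullet> z = 0} \<le> dim H"
    using dim_hyperplane[OF a(1)] assms(2) by simp
  ultimately have "H = {z. a \<bullet> z = 0}"
    using subspace_dim_equal[OF assms(1) subspace_hyperplane] by blast
  with a(1) show thesis by (rule that)
qed

text \<open>
  A slice chart maps \<open>P\<close> to a hyperplane with normal vector \<open>a\<close>; the equation is \<open>a\<close> paired with
  the slice chart, written in product coordinates. Its differential is nonzero since the change from
  product to slice coordinates has a differentiable inverse.
\<close>

lemma obtain_chart_equation:
  fixes M :: "('a, 'e::euclidean_space) manifold" and N :: "('b, 'f::euclidean_space) manifold"
  assumes M: "c1_charts M" and N: "c1_charts N"
    and P: "c1_submanifold (prod_manifold M N) 1 P" "(x\<^sub>0, y\<^sub>0) \<in> P"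
  obtains U \<phi> V \<psi> \<Omega> F D w where "chart_equation M N P U \<phi> V \<psi> \<Omega> F"
    "x\<^sub>0 \<in> U" "y\<^sub>0 \<in> V" "(\<phi> x\<^sub>0, \<psi> y\<^sub>0) \<in> \<Omega>"
    "(F has_derivative D) (at (\<phi> x\<^sub>0, \<psi> y\<^sub>0))" "D w \<noteq> 0"
proof -
  let ?MN = "prod_manifold M N"
  from P obtain W \<kappa> H where W: "(W, \<kappa>) \<in> maximal_atlas ?MN" "(x\<^sub>0, y\<^sub>0) \<in> W"
    and H: "subspace H" "dim H + 1 = DIM('e \<times> 'f)" "\<kappa> ` (W \<inter> P) = \<kappa> ` W \<inter> H"
    unfolding c1_submanifold_def by blast
  obtain a where a: "a \<noteq> 0" "H = {z. a \<bullet> z = 0}"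
    using hyperplane_of_codim_1[OF H(1,2)] .
  have "(x\<^sub>0, y\<^sub>0) \<in> topspace (mtop ?MN)" using P by (auto simp: c1_submanifold_def)
  then have top: "x\<^sub>0 \<in> topspace (mtop M)" "y\<^sub>0 \<in> topspace (mtop N)"
    by (auto simp: prod_manifold_def)
  obtain U \<phi> where U: "(U, \<phi>) \<in> atlas M" "x\<^sub>0 \<in> U" using c1_charts_obtain[OF M top(1)] .
  obtain V \<psi> where V: "(V, \<psi>) \<in> atlas N" "y\<^sub>0 \<in> V" using c1_charts_obtain[OF N top(2)] .
  define C where "C = U \<times> V"
  define \<Phi> where "\<Phi> = map_prod \<phi> \<psi>"
  have C: "(C, \<Phi>) \<in> atlas ?MN" using U V by (auto simp: C_def \<Phi>_def prod_manifold_def)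
  note inj\<Phi> = chart_on_inj[OF c1_charts_chart_on[OF c1_charts_prod[OF M N] C]]
  have \<kappa>: "chart_on (mtop ?MN) (W, \<kappa>)" "c1_compatible (W, \<kappa>) (C, \<Phi>)"
    using W(1) C by (auto simp: maximal_atlas_def)
  note inj\<kappa> = chart_on_inj[OF \<kappa>(1)]
  from \<kappa>(2) have fwd: "c1_on (\<lambda>z. \<kappa> (inv_into C \<Phi> z)) (\<Phi> ` (C \<inter> W))"
    and bwd: "c1_on (\<lambda>z. \<Phi> (inv_into W \<kappa> z)) (\<kappa> ` (W \<inter> C))"
    by (auto simp: c1_compatible_def o_def Int_commute)
  define \<Omega> where "\<Omega> = \<Phi> ` (C \<inter> W)"
  define F where "F = (\<lambda>z. a \<bullet> \<kappa> (inv_into C \<Phi> z))"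
  have F_eq: "F (\<Phi> w) = a \<bullet> \<kappa> w" if "w \<in> C" for w
    using that by (simp add: F_def inv_into_f_f[OF inj\<Phi>])
  have F_c1: "c1_on F \<Omega>"
    unfolding F_def \<Omega>_def
    using c1_on_compose[OF fwd c1_on_bounded_linear[OF bounded_linear_inner_right open_UNIV]] by simp
  have mem_P: "w \<in> P \<longleftrightarrow> F (\<Phi> w) = 0" if "w \<in> C" "w \<in> W" for w
  proof -
    have "w \<in> P \<longleftrightarrow> \<kappa> w \<in> \<kappa> ` (W \<inter> P)"
      using that(2) inj\<kappa> by (auto dest: inj_onD)
    also have "\<dots> \<longleftrightarrow> a \<bullet> \<kappa> w = 0" using that(2) H(3) a(2) by auto
    finally show ?thesis using F_eq that(1) by simp
  qed
  have eq: "chart_equation M N P U \<phi> V \<psi> \<Omega> F"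
  proof
    show "\<Omega> \<subseteq> \<phi> ` U \<times> \<psi> ` V" by (auto simp: \<Omega>_def C_def \<Phi>_def)
    fix x y assume xy: "x \<in> U" "y \<in> V" "(\<phi> x, \<psi> y) \<in> \<Omega>"
    then have "\<Phi> (x, y) \<in> \<Phi> ` (C \<inter> W)" "(x, y) \<in> C" by (auto simp: \<Phi>_def \<Omega>_def C_def)
    then have "(x, y) \<in> W" using inj\<Phi> by (auto dest: inj_onD)
    with \<open>(x, y) \<in> C\<close> show "(x, y) \<in> P \<longleftrightarrow> F (\<phi> x, \<psi> y) = 0"
      using mem_P by (force simp: \<Phi>_def)
  qed (use M N U V F_c1 in auto)
  have w0: "(x\<^sub>0, y\<^sub>0) \<in> C" "(x\<^sub>0, y\<^sub>0) \<in> W" "\<Phi> (x\<^sub>0, y\<^sub>0) = (\<phi> x\<^sub>0, \<psi> y\<^sub>0)"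
    using U V W by (auto simp: C_def \<Phi>_def)
  then have z0: "(\<phi> x\<^sub>0, \<psi> y\<^sub>0) \<in> \<Omega>" by (force simp: \<Omega>_def)
  let ?D = "frechet_derivative F (at (\<phi> x\<^sub>0, \<psi> y\<^sub>0))"
  have D: "(F has_derivative ?D) (at (\<phi> x\<^sub>0, \<psi> y\<^sub>0))"
    using F_c1 z0 by (rule c1_on_has_derivative)
  let ?\<tau> = "\<lambda>z. \<Phi> (inv_into W \<kappa> z)" and ?p = "\<kappa> (x\<^sub>0, y\<^sub>0)"
  have p: "?p \<in> \<kappa> ` (W \<inter> C)" using w0 by blast
  obtain T where T: "(?\<tau> has_derivative T) (at ?p)"
    using c1_on_has_derivative[OF bwd p] by blast
  have "?\<tau> ?p = (\<phi> x\<^sub>0, \<psi> y\<^sub>0)" using w0 by (simp add: inv_into_f_f[OF inj\<kappa>])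
  with D have "(F has_derivative ?D) (at (?\<tau> ?p))" by simp
  from has_derivative_compose[OF T this]
  have "((\<lambda>z. F (?\<tau> z)) has_derivative (\<lambda>h. ?D (T h))) (at ?p)" .
  moreover have "((\<lambda>z. F (?\<tau> z)) has_derivative (\<lambda>h. a \<bullet> h)) (at ?p)"
  proof (rule has_derivative_transform_within_open)
    show "((\<lambda>z. a \<bullet> z) has_derivative (\<lambda>h. a \<bullet> h)) (at ?p)"
      by (rule bounded_linear_imp_has_derivative[OF bounded_linear_inner_right])
    show "a \<bullet> z = F (?\<tau> z)" if "z \<in> \<kappa> ` (W \<inter> C)" for z
      using that F_eq by (auto simp: inv_into_f_f[OF inj\<kappa>])
  qed (use p bwd c1_on_imp_open in auto)
  ultimately have "(\<lambda>h. ?D (T h)) = (\<lambda>h. a \<bullet> h)" by (rule has_derivative_unique)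
  then have "?D (T a) \<noteq> 0" using a(1) by (metis inner_eq_zero_iff)
  with eq U(2) V(2) z0 D show thesis by (rule that)
qed

section \<open>Equivalence of the three conditions\<close>

text \<open>
  A curve through \<open>y\<close> stays in \<open>V\<close> for small times, and there both sets are the level set of \<open>g\<close>
  through \<open>y\<close>; so both tangent spaces consist of the velocities of the same curves.
\<close>

lemma sub_tangent_space_level_eq:
  assumes V: "openin (mtop N) V" "y \<in> V"
    and S: "\<And>y'. y' \<in> V \<Longrightarrow> y' \<in> S \<longleftrightarrow> g y' = g y" and T: "\<And>y'. y' \<in> V \<Longrightarrow> y' \<in> T \<longleftrightarrow> g y' = g y"
  shows "sub_tangent_space N S y = sub_tangent_space N T y"
proof -
  have "(\<forall>\<^sub>F t in nhds 0. \<gamma> t \<in> S) \<longleftrightarrow> (\<forall>\<^sub>F t in nhds 0. \<gamma> t \<in> T)" if "c1_curve_at N y \<gamma>" for \<gamma>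
  proof (rule eventually_cong[OF c1_curve_at_eventually_in[OF that V]])
    show "\<gamma> t \<in> S \<longleftrightarrow> \<gamma> t \<in> T" if "\<gamma> t \<in> V" for t using S T that by simp
  qed
  then show ?thesis unfolding sub_tangent_space_def by blast
qed

lemma transverse_nhds_Int:
  assumes "transverse_nhds M N P (x, y) A B" "openin (mtop M) U" "x \<in> U" "openin (mtop N) V" "y \<in> V"
  shows "transverse_nhds M N P (x, y) (A \<inter> U) (B \<inter> V)"
  using assms by (auto simp: transverse_nhds_def)

theorem theorem1p4:
  fixes M :: "('a, 'e::euclidean_space) manifold"
    and N :: "('b, 'f::euclidean_space) manifold"
    and P :: "('a \<times> 'b) set"
    and x\<^sub>0 :: 'a and y\<^sub>0 :: 'b
  assumes "c1_manifold M" and "c1_manifold N"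
    and "c1_submanifold (prod_manifold M N) 1 P"
    and "(x\<^sub>0, y\<^sub>0) \<in> P"
    and "transverse_at M N P (x\<^sub>0, y\<^sub>0)"
  shows
    "let
       cond1 = (\<exists>U V. transverse_nhds M N P (x\<^sub>0, y\<^sub>0) U V \<and>
         (\<forall>x\<in>U. \<forall>x'\<in>U. \<forall>y\<in>V. (x, y) \<in> P \<longrightarrow> (x', y) \<in> P \<longrightarrow>
            sub_tangent_space N (xslice P x) y = sub_tangent_space N (xslice P x') y));
       cond2 = (\<exists>U V. transverse_nhds M N P (x\<^sub>0, y\<^sub>0) U V \<and>
         (\<forall>x\<in>U. \<forall>y\<in>V. \<forall>y'\<in>V. (x, y) \<in> P \<longrightarrow> (x, y') \<in> P \<longrightarrow>
            sub_tangent_space M (yslice P y) x = sub_tangent_space M (yslice P y') x));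
       cond3 = (\<exists>U V (f :: 'a \<Rightarrow> real) (g :: 'b \<Rightarrow> real).
         openin (mtop M) U \<and> x\<^sub>0 \<in> U \<and> openin (mtop N) V \<and> y\<^sub>0 \<in> V \<and>
         c1_submersion_on M euclidean_manifold U f \<and>
         c1_submersion_on N euclidean_manifold V g \<and>
         P \<inter> (U \<times> V) = {(x, y). x \<in> U \<and> y \<in> V \<and> f x = g y})
     in (cond1 \<longleftrightarrow> cond2) \<and> (cond2 \<longleftrightarrow> cond3)"
proof -
  define cond1 where "cond1 \<longleftrightarrow> (\<exists>U V. transverse_nhds M N P (x\<^sub>0, y\<^sub>0) U V \<and>
         (\<forall>x\<in>U. \<forall>x'\<in>U. \<forall>y\<in>V. (x, y) \<in> P \<longrightarrow> (x', y) \<in> P \<longrightarrow>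
            sub_tangent_space N (xslice P x) y = sub_tangent_space N (xslice P x') y))"
  define cond2 where "cond2 \<longleftrightarrow> (\<exists>U V. transverse_nhds M N P (x\<^sub>0, y\<^sub>0) U V \<and>
         (\<forall>x\<in>U. \<forall>y\<in>V. \<forall>y'\<in>V. (x, y) \<in> P \<longrightarrow> (x, y') \<in> P \<longrightarrow>
            sub_tangent_space M (yslice P y) x = sub_tangent_space M (yslice P y') x))"
  define cond3 where "cond3 \<longleftrightarrow> (\<exists>U V (f :: 'a \<Rightarrow> real) (g :: 'b \<Rightarrow> real).
         openin (mtop M) U \<and> x\<^sub>0 \<in> U \<and> openin (mtop N) V \<and> y\<^sub>0 \<in> V \<and>
         c1_submersion_on M euclidean_manifold U f \<and>
         c1_submersion_on N euclidean_manifold V g \<and>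
         P \<inter> (U \<times> V) = {(x, y). x \<in> U \<and> y \<in> V \<and> f x = g y})"
  note charts = c1_manifold_imp_c1_charts[OF assms(1)] c1_manifold_imp_c1_charts[OF assms(2)]
  obtain U \<phi> V \<psi> \<Omega> F D w where "chart_equation M N P U \<phi> V \<psi> \<Omega> F"
    and xy: "x\<^sub>0 \<in> U" "y\<^sub>0 \<in> V" "(\<phi> x\<^sub>0, \<psi> y\<^sub>0) \<in> \<Omega>"
    and D: "(F has_derivative D) (at (\<phi> x\<^sub>0, \<psi> y\<^sub>0))" "D w \<noteq> 0"
    using obtain_chart_equation[OF charts assms(3,4)] .
  then interpret chart_equation M N P U \<phi> V \<psi> \<Omega> F by blast
  obtain u v where uv: "D (u, 0) \<noteq> 0" "D (0, v) \<noteq> 0"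
    using transverse_imp_nonzero[OF xy D assms(5)] .
  obtain A B where AB: "transverse_nhds M N P (x\<^sub>0, y\<^sub>0) A B"
    using obtain_transverse_nhds[OF xy D(1) uv] .
  interpret swapped: chart_equation N M "P\<inverse>" V \<psi> U \<phi> "prod.swap -` \<Omega>" "\<lambda>z. F (prod.swap z)"
    by (rule swap)
  note D' = has_derivative_swap[OF D(1)]

  have "cond3" if "cond1"
  proof -
    from that obtain X Y where XY: "transverse_nhds M N P (x\<^sub>0, y\<^sub>0) X Y"
      "\<And>x x' y. x \<in> X \<Longrightarrow> x' \<in> X \<Longrightarrow> y \<in> Y \<Longrightarrow> (x, y) \<in> P \<Longrightarrow> (x', y) \<in> P \<Longrightarrow>
        sub_tangent_space N (xslice P x) y = sub_tangent_space N (xslice P x') y"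
      unfolding cond1_def by blast
    then have "openin (mtop M) X" "x\<^sub>0 \<in> X" "openin (mtop N) Y" "y\<^sub>0 \<in> Y"
      by (auto simp: transverse_nhds_def)
    then show ?thesis
      unfolding cond3_def by (rule constant_tangents_imp_separated[OF xy assms(4) D(1) uv]) (rule XY(2))
  qed
  moreover have "cond3" if "cond2"
  proof -
    from that obtain X Y where XY: "transverse_nhds M N P (x\<^sub>0, y\<^sub>0) X Y"
      "\<And>x y y'. x \<in> X \<Longrightarrow> y \<in> Y \<Longrightarrow> y' \<in> Y \<Longrightarrow> (x, y) \<in> P \<Longrightarrow> (x, y') \<in> P \<Longrightarrow>
        sub_tangent_space M (yslice P y) x = sub_tangent_space M (yslice P y') x"
      unfolding cond2_def by blast
    have slice: "xslice (P\<inverse>) y = yslice P y" for y by (auto simp: xslice_def yslice_def)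
    have "\<exists>B A (g :: 'b \<Rightarrow> real) (f :: 'a \<Rightarrow> real).
      openin (mtop N) B \<and> y\<^sub>0 \<in> B \<and> openin (mtop M) A \<and> x\<^sub>0 \<in> A \<and>
      c1_submersion_on N euclidean_manifold B g \<and> c1_submersion_on M euclidean_manifold A f \<and>
      P\<inverse> \<inter> (B \<times> A) = {(y, x). y \<in> B \<and> x \<in> A \<and> g y = f x}"
    proof (rule swapped.constant_tangents_imp_separated[OF xy(2,1) _ _ D', of v u Y X])
      show "sub_tangent_space M (xslice (P\<inverse>) y) x = sub_tangent_space M (xslice (P\<inverse>) y') x"
        if "y \<in> Y" "y' \<in> Y" "x \<in> X" "(y, x) \<in> P\<inverse>" "(y', x) \<in> P\<inverse>" for y y' x
        unfolding slice by (rule XY(2)) (use that in auto)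
    qed (use xy assms(4) uv XY(1) in \<open>auto simp: transverse_nhds_def\<close>)
    then obtain B A and g :: "'b \<Rightarrow> real" and f :: "'a \<Rightarrow> real" where
      "openin (mtop N) B" "y\<^sub>0 \<in> B" "openin (mtop M) A" "x\<^sub>0 \<in> A"
      "c1_submersion_on N euclidean_manifold B g" "c1_submersion_on M euclidean_manifold A f"
      and sep: "P\<inverse> \<inter> (B \<times> A) = {(y, x). y \<in> B \<and> x \<in> A \<and> g y = f x}"
      by blast
    moreover have "P \<inter> (A \<times> B) = {(x, y). x \<in> A \<and> y \<in> B \<and> f x = g y}"
    proof -
      have "(y, x) \<in> P\<inverse> \<longleftrightarrow> g y = f x" if "x \<in> A" "y \<in> B" for x y
        using sep that by blast
      then show ?thesis by auto
    qed
    ultimately show ?thesis unfolding cond3_def by blast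
  qed
  moreover have "cond1 \<and> cond2" if "cond3"
  proof -
    from that obtain X Y and f :: "'a \<Rightarrow> real" and g :: "'b \<Rightarrow> real" where
      XY: "openin (mtop M) X" "x\<^sub>0 \<in> X" "openin (mtop N) Y" "y\<^sub>0 \<in> Y"
      and sep: "P \<inter> (X \<times> Y) = {(x, y). x \<in> X \<and> y \<in> Y \<and> f x = g y}"
      unfolding cond3_def by blast
    have nhds: "transverse_nhds M N P (x\<^sub>0, y\<^sub>0) (A \<inter> X) (B \<inter> Y)"
      using AB XY by (rule transverse_nhds_Int)
    have P_iff: "(x, y) \<in> P \<longleftrightarrow> f x = g y" if "x \<in> X" "y \<in> Y" for x y
      using sep that by blast
    have "sub_tangent_space N (xslice P x) y = sub_tangent_space N (xslice P x') y"
      if "x \<in> X" "x' \<in> X" "y \<in> Y" "(x, y) \<in> P" "(x', y) \<in> P" for x x' y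
      using that by (intro sub_tangent_space_level_eq[OF XY(3), of y _ g]) (auto simp: xslice_def P_iff)
    moreover have "sub_tangent_space M (yslice P y) x = sub_tangent_space M (yslice P y') x"
      if "x \<in> X" "y \<in> Y" "y' \<in> Y" "(x, y) \<in> P" "(x, y') \<in> P" for x y y'
      using that by (intro sub_tangent_space_level_eq[OF XY(1), of x _ f]) (auto simp: yslice_def P_iff)
    ultimately show ?thesis
      unfolding cond1_def cond2_def using nhds by blast
  qed
  ultimately have "(cond1 \<longleftrightarrow> cond2) \<and> (cond2 \<longleftrightarrow> cond3)" by blast
  then show ?thesis unfolding Let_def cond1_def cond2_def cond3_def .
qed

end
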